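(* Let $K=2^m$ ($m\in\mathbb{N}$), $n\ge1$, $L\ge1$, $d\ge K$, and let $U=\frac{1}{\sqrt K}\Phi$ where $\Phi$ is the $K\times K$ Sylvester Hadamard matrix. Let $Q\in\mathbb{R}^{n\times n}$ be orthogonal with $1_n^T=\sqrt n\, e_1^TQ^T$ ($e_1$ the first standard basis vector of $\mathbb{R}^n$), and set $V=U\otimes Q\in\mathbb{R}^{nK\times nK}$. Consider gradient flow $\frac{d\theta}{dt}=-\nabla_\theta\mathcal{L}$ on the deep UFM cross-entropy loss $\mathcal{L}$ with initialization $$W_L=UD_LR_L^T,\quad W_l=R_{l+1}D_lR_l^T\ (l=1,\dots,L-1),\quad H_1=R_1D_0V^T,$$ where $R_1,\dots,R_L\in\mathbb{R}^{d\times d}$ are orthogonal and each $D_l$ (of size $K\times d$, $d\times d$, or $d\times nK$ respectively) is rectangular diagonal whose only possibly nonzero diagonal entries are its first $K$ entries $\alpha^{(l)}_0,\dots,\alpha^{(l)}_{K-1}\ge 0$. Then along the flow the matrices $U,V,R_1,\dots,R_L$ stay fixed and only the $\alpha_i^{(l)}$ evolve; the quantities $(\alpha_i^{(l)})^2-(\alpha_i^{(r)})^2$ are conserved, and $\alpha^{(l)}_0$ is constant for all $l$. Assume balancedness, $\alpha_i^{(l)}=\alpha_i^{(r)}$ for all $l,r\in\{0,\dots,L\}$ and all $i$, and let $a_i=\prod_{l=0}^L\alpha_i^{(l)}$ be the logit singular values. After the change of variables $a'=\frac{1}{K\sqrt n}a$, $t'=\frac{1}{K}(L+1)(K\sqrt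 n)^{\frac{2L}{L+1}}t$ (and dropping primes), the values $a_1,\dots,a_{K-1}$ satisfy $$\frac{da_i}{dt}=\frac{1}{D}\,b_i\,a_i^{\frac{2L}{L+1}},\qquad i=1,\dots,K-1,$$ where $b_i=\sum_{j=1}^{K-1}\Psi_{ij}e^{-(\Psi a)_j}$, $D=1+\sum_{j=1}^{K-1}e^{-(\Psi a)_j}$, $a=(a_1,\dots,a_{K-1})$.
   Context: Sylvester Hadamard matrices: $\Phi_1=(1)$ and $\Phi_{2^m}=\begin{bmatrix}\Phi_{2^{m-1}}&\Phi_{2^{m-1}}\\ \Phi_{2^{m-1}}&-\Phi_{2^{m-1}}\end{bmatrix}$; rows/columns are indexed $0,\dots,K-1$. $\Psi\in\mathbb{R}^{(K-1)\times(K-1)}$ is the matrix obtained from $1_K1_K^T-\Phi$ by deleting its first row and first column. Deep UFM: parameters $W_L\in\mathbb{R}^{K\times d}$, $W_{L-1},\dots,W_1\in\mathbb{R}^{d\times d}$, $H_1\in\mathbb{R}^{d\times nK}$, logit matrix $Z=W_L\cdots W_1H_1\in\mathbb{R}^{K\times nK}$ with columns $z_{ic}$ ordered by class (column $(c-1)n+i$ for sample $i$ of class $c$), and loss $\mathcal{L}=-\sum_{c=1}^K\sum_{i=1}^n\log\frac{\exp((z_{ic})_c)}{\sum_{c'}\exp((z_{ic})_{c'})}$.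
   Formalization: The nonzero entries of D_0 are placed at positions (k, kn), k=0..K-1, so that α_k^(0) pairs with the column u_k⊗(1/√n)1_n of V, instead of at (k,k); with the literal diagonal placement the invariance claim fails for n>1 (the two agree for n=1). *)

theory Defs
  imports "HOL-Analysis.Analysis"
begin

text \<open>Sylvester Hadamard matrix Phi_{2^m}, entries indexed 0..2^m-1.\<close>
fun sylvester :: "nat \<Rightarrow> nat \<Rightarrow> nat \<Rightarrow> real" where
  "sylvester 0 i j = 1"
| "sylvester (Suc m) i j =
     (if 2^m \<le> i \<and> 2^m \<le> j then -1 else 1) * sylvester m (i mod 2^m) (j mod 2^m)"

definition hadamardU :: "nat \<Rightarrow> nat \<Rightarrow> nat \<Rightarrow> real" where
  "hadamardU m i j = sylvester m i j / sqrt (2^m)"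

definition kron :: "nat \<Rightarrow> (nat \<Rightarrow> nat \<Rightarrow> real) \<Rightarrow> (nat \<Rightarrow> nat \<Rightarrow> real) \<Rightarrow> nat \<Rightarrow> nat \<Rightarrow> real" where
  "kron n A B a b = A (a div n) (b div n) * B (a mod n) (b mod n)"

text \<open>Psi = (1 1^T - Phi) with first row/column deleted; used for indices i,j in 1..K-1
  (so Psi i j here is the paper's Psi_{ij}).\<close>
definition Psi :: "nat \<Rightarrow> nat \<Rightarrow> nat \<Rightarrow> real" where
  "Psi m i j = 1 - sylvester m i j"

text \<open>Parameters: layer 0 is H_1 (d x nK), layer l (1 \<le> l \<le> L-1) is W_l (d x d),
  layer L is W_L (K x d).  Entry (i,j) of layer l is \<theta> l i j.\<close>
type_synonym params = "nat \<Rightarrow> nat \<Rightarrow> nat \<Rightarrow> real"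

definition layer_rows :: "nat \<Rightarrow> nat \<Rightarrow> nat \<Rightarrow> nat \<Rightarrow> nat" where
  "layer_rows K d L l = (if l = L then K else d)"

definition layer_cols :: "nat \<Rightarrow> nat \<Rightarrow> nat \<Rightarrow> nat \<Rightarrow> nat" where
  "layer_cols n K d l = (if l = 0 then n * K else d)"

fun fwd :: "nat \<Rightarrow> params \<Rightarrow> nat \<Rightarrow> nat \<Rightarrow> nat \<Rightarrow> real" where
  "fwd d \<theta> 0 = \<theta> 0"
| "fwd d \<theta> (Suc l) = (\<lambda>i j. \<Sum>k<d. \<theta> (Suc l) i k * fwd d \<theta> l k j)"

definition logits :: "nat \<Rightarrow> nat \<Rightarrow> params \<Rightarrow> nat \<Rightarrow> nat \<Rightarrow> real" where
  "logits d L \<theta> = fwd d \<theta> L"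

text \<open>Cross-entropy loss; classes c = 0..K-1, sample i of class c is column c*n+i.\<close>
definition ufm_loss :: "nat \<Rightarrow> nat \<Rightarrow> nat \<Rightarrow> nat \<Rightarrow> params \<Rightarrow> real" where
  "ufm_loss K n d L \<theta> =
     - (\<Sum>c<K. \<Sum>i<n. ln (exp (logits d L \<theta> c (c*n+i)) /
                           (\<Sum>c'<K. exp (logits d L \<theta> c' (c*n+i)))))"

definition upd_entry :: "params \<Rightarrow> nat \<Rightarrow> nat \<Rightarrow> nat \<Rightarrow> real \<Rightarrow> params" where
  "upd_entry \<theta> l i j h = \<theta>(l := (\<theta> l)(i := (\<theta> l i)(j := \<theta> l i j + h)))"

definition partial_at :: "(params \<Rightarrow> real) \<Rightarrow> params \<Rightarrow> nat \<Rightarrow> nat \<Rightarrow> nat \<Rightarrow> real" where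
  "partial_at f \<theta> l i j = deriv (\<lambda>h. f (upd_entry \<theta> l i j h)) 0"

definition is_grad_flow :: "nat \<Rightarrow> nat \<Rightarrow> nat \<Rightarrow> nat \<Rightarrow> (real \<Rightarrow> params) \<Rightarrow> bool" where
  "is_grad_flow K n d L \<theta> \<longleftrightarrow>
     (\<forall>t\<ge>0. \<forall>l\<le>L. \<forall>i<layer_rows K d L l. \<forall>j<layer_cols n K d l.
        ((\<lambda>s. \<theta> s l i j) has_real_derivative (- partial_at (ufm_loss K n d L) (\<theta> t) l i j))
          (at t within {0..}))"

definition orthogonal_mat :: "nat \<Rightarrow> (nat \<Rightarrow> nat \<Rightarrow> real) \<Rightarrow> bool" where
  "orthogonal_mat n A \<longleftrightarrow>
     (\<forall>i<n. \<forall>j<n. (\<Sum>k<n. A i k * A j k) = (if i = j then 1 else 0))"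

definition init_form :: "nat \<Rightarrow> nat \<Rightarrow> nat \<Rightarrow> (nat \<Rightarrow> nat \<Rightarrow> real) \<Rightarrow> (nat \<Rightarrow> nat \<Rightarrow> real)
    \<Rightarrow> (nat \<Rightarrow> nat \<Rightarrow> nat \<Rightarrow> real) \<Rightarrow> (nat \<Rightarrow> nat \<Rightarrow> real) \<Rightarrow> params" where
  "init_form K n L U V R \<alpha> l i j =
     (if l = L then (\<Sum>k<K. U i k * \<alpha> L k * R L j k)
      else if l = 0 then (\<Sum>k<K. R 1 i k * \<alpha> 0 k * V j (k * n))
      else (\<Sum>k<K. R (Suc l) i k * \<alpha> l k * R l j k))"

end

theory Submission
  imports Defs
begin

text \<open>Call parameters aligned if layer \<open>l\<close> is diagonal in the given singular bases. The rows of the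
  Sylvester matrix form a group under entrywise multiplication, so for aligned parameters every column
  of the softmax residual is a translate of a single vector, and the residual is again diagonal in the
  Hadamard bases; hence the gradient at an aligned point is aligned. Let \<open>E\<close> be the deviation of the
  flow from its orthogonal projection to the aligned parameters. Since the gradient is locally Lipschitz,
  \<open>\<bar>E'\<bar> \<le> C \<bar>E\<bar>\<close> on compact time intervals, and Gronwall's inequality keeps \<open>E = 0\<close>. What remains
  is the scalar system \<open>\<alpha>\<^sub>l' = - \<gamma> \<Prod>\<^bsub>s \<noteq> l\<^esub> \<alpha>\<^sub>s\<close> for every singular direction, where \<open>\<gamma>\<close> is the
  coefficient of the residual in that direction.\<close>

section \<open>The gradient of the cross-entropy loss\<close>

text \<open>The flow is only a hypothesis, so the singular values are read off from
  \<open>\<theta>\<close> by projection; solving the scalar system and then appealing to uniqueness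
  would require global existence first. The projection \<open>P\<close> is linear and independent of
  time, so the deviation obeys \<open>E' = -(F - P F)\<close> with \<open>F\<close> the gradient
  along the flow. The gradient \<open>G\<close> at the projected point satisfies
  \<open>P G = G\<close>, hence \<open>E'\<close> depends only on \<open>F - G\<close>; this is
  where the bound by \<open>E\<close> comes from. Apart from orthonormality of the bases, the
  Hadamard structure enters the invariance argument only through the assumption
  \<open>residual_frame\<close>. The scale \<open>K * sqrt n\<close> is the reciprocal of the size
  of a product of an entry of \<open>U\<close> and an entry of a used column of \<open>V\<close>:
  dividing by it leaves the matrix of signs. In the balanced case the conserved quantities fix the
  layers only up to sign, and the fractional power calls for a nonnegative base; both points are
  settled by linear scalar equations.\<close>

definition softmax :: "nat \<Rightarrow> (nat \<Rightarrow> nat \<Rightarrow> real) \<Rightarrow> nat \<Rightarrow> nat \<Rightarrow> real" where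
  "softmax K Z a c = inverse (\<Sum>b<K. exp (Z b c - Z a c))"

definition residual :: "nat \<Rightarrow> nat \<Rightarrow> (nat \<Rightarrow> nat \<Rightarrow> real) \<Rightarrow> nat \<Rightarrow> nat \<Rightarrow> real" where
  "residual K n Z a c = softmax K Z a c - of_bool (a = c div n)"

text \<open>\<open>downstream d \<theta> l r a i\<close> is the \<open>(a, i)\<close> entry of \<open>W\<^sub>r \<cdots> W\<^bsub>l+1\<^esub>\<close>.\<close>
primrec downstream :: "nat \<Rightarrow> params \<Rightarrow> nat \<Rightarrow> nat \<Rightarrow> nat \<Rightarrow> nat \<Rightarrow> real" where
  "downstream d \<theta> l 0 a i = of_bool (a = i)"
| "downstream d \<theta> l (Suc r) a i =
     (if Suc r \<le> l then of_bool (a = i) else \<Sum>k<d. \<theta> (Suc r) a k * downstream d \<theta> l r k i)"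

text \<open>At layer 0 the input is the identity matrix, so that \<open>H_1\<close> counts as one
  more linear layer and a single gradient formula serves all layers.\<close>

definition layer_input :: "nat \<Rightarrow> params \<Rightarrow> nat \<Rightarrow> nat \<Rightarrow> nat \<Rightarrow> real" where
  "layer_input d \<theta> l j c = (if l = 0 then of_bool (j = c) else fwd d \<theta> (l - 1) j c)"

text \<open>Backpropagation: (product of the layers above)^T times the loss derivative in the logits
  times (input of the layer)^T.\<close>

definition loss_grad :: "nat \<Rightarrow> nat \<Rightarrow> nat \<Rightarrow> nat \<Rightarrow> params \<Rightarrow> params" where
  "loss_grad K n d L \<theta> l i j =
     (\<Sum>c<n * K. \<Sum>a<K. residual K n (logits d L \<theta>) a c * downstream d \<theta> l L a i * layer_input d \<theta> l j c)"

lemma softmax_eq: "softmax K Z a c = exp (Z a c) / (\<Sum>b<K. exp (Z b c))"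
  by (simp add: softmax_def exp_diff flip: sum_divide_distrib)

lemma downstream_self: "r \<le> l \<Longrightarrow> downstream d \<theta> l r a i = of_bool (a = i)"
  by (cases r) auto

lemma fwd_upd_entry_before: "r < l \<Longrightarrow> fwd d (upd_entry \<theta> l i j h) r = fwd d \<theta> r"
  by (induction r) (auto simp: upd_entry_def)

text \<open>The network is multilinear in its layers, so it is affine in every single weight.\<close>
lemma fwd_upd_entry:
  assumes "l \<le> r" and "i < layer_rows K d L l" "j < layer_cols n K d l" "r \<le> L"
  shows "fwd d (upd_entry \<theta> l i j h) r a c =
    fwd d \<theta> r a c + h * (downstream d \<theta> l r a i * layer_input d \<theta> l j c)"
  using assms(1,4)
proof (induction r arbitrary: a rule: dec_induct)
  case base
  show ?case
  proof (cases l)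
    case 0
    then show ?thesis by (auto simp: upd_entry_def layer_input_def)
  next
    case (Suc r)
    have jd: "j < d" using assms(3) Suc by (simp add: layer_cols_def)
    have "fwd d (upd_entry \<theta> l i j h) l a c =
        (\<Sum>k<d. (\<theta> l a k + of_bool (a = i) * of_bool (k = j) * h) * fwd d \<theta> r k c)"
      using fwd_upd_entry_before[of r l d \<theta> i j h] Suc
      by (auto simp: upd_entry_def intro!: sum.cong)
    also have "\<dots> = (\<Sum>k<d. \<theta> l a k * fwd d \<theta> r k c) +
        (\<Sum>k<d. if k = j then of_bool (a = i) * h * fwd d \<theta> r j c else 0)"
      unfolding sum.distrib[symmetric] by (rule sum.cong) (auto simp: algebra_simps)
    also have "\<dots> = fwd d \<theta> l a c + h * (downstream d \<theta> l l a i * layer_input d \<theta> l j c)"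
      using jd Suc by (simp add: downstream_self layer_input_def)
    finally show ?thesis .
  qed
next
  case (step r)
  have unchanged: "upd_entry \<theta> l i j h (Suc r) = \<theta> (Suc r)"
    using step(1) by (simp add: upd_entry_def)
  have "fwd d (upd_entry \<theta> l i j h) (Suc r) a c =
     (\<Sum>k<d. \<theta> (Suc r) a k * (fwd d \<theta> r k c + h * (downstream d \<theta> l r k i * layer_input d \<theta> l j c)))"
    using step(1,4) step.IH by (simp add: unchanged)
  then show ?case
    using step(1) by (simp add: algebra_simps sum.distrib sum_distrib_left sum_distrib_right)
qed

text \<open>Differentiation along a line in logit space suffices, since moving a single weight moves
  the logits along a line.\<close>

lemma cross_entropy_has_derivative:
  fixes z w :: "nat \<Rightarrow> real"
  assumes "c < K"
  shows "((\<lambda>h. ln (exp (z c + h * w c) / (\<Sum>b<K. exp (z b + h * w b)))) has_real_derivative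
    w c - (\<Sum>a<K. exp (z a) / (\<Sum>b<K. exp (z b)) * w a)) (at 0)"
proof -
  have pos: "(\<Sum>b<K. exp (z b + h * w b)) > 0" for h
    using assms by (intro sum_pos) auto
  have *: "ln (exp (z c + h * w c) / (\<Sum>b<K. exp (z b + h * w b))) =
      z c + h * w c - ln (\<Sum>b<K. exp (z b + h * w b))" for h
    using pos[of h] by (simp add: ln_div)
  have "((\<lambda>h. z c + h * w c - ln (\<Sum>b<K. exp (z b + h * w b))) has_real_derivative
      w c - (\<Sum>b<K. exp (z b) * w b) / (\<Sum>b<K. exp (z b))) (at 0)"
    using pos[of 0] by (auto intro!: derivative_eq_intros simp: divide_simps)
  then show ?thesis
    unfolding * by (simp add: sum_divide_distrib)
qed

lemma sum_nat_blocks: "(\<Sum>c<K. \<Sum>i<n. f (c * n + i)) = (\<Sum>k<n * K. f k)"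
  for f :: "nat \<Rightarrow> real"
proof -
  have "(\<Sum>i<n. f (c * n + i)) = sum f {c * n..<c * n + n}" for c
    using sum.shift_bounds_nat_ivl[of f 0 "c * n" n]
    by (simp add: add.commute lessThan_atLeast0)
  then show ?thesis by (simp add: sum.nat_group mult.commute)
qed

lemma partial_at_ufm_loss:
  assumes "l \<le> L" "i < layer_rows K d L l" "j < layer_cols n K d l"
  shows "partial_at (ufm_loss K n d L) \<theta> l i j = loss_grad K n d L \<theta> l i j"
proof -
  define Z where "Z = logits d L \<theta>"
  define w where "w a c = downstream d \<theta> l L a i * layer_input d \<theta> l j c" for a c
  have Zh: "logits d L (upd_entry \<theta> l i j h) a c = Z a c + h * w a c" for h a c
    unfolding logits_def Z_def w_def using fwd_upd_entry[OF assms order_refl] by simp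
  have "((\<lambda>h. ufm_loss K n d L (upd_entry \<theta> l i j h)) has_real_derivative
     - (\<Sum>c<K. \<Sum>s<n. w c (c*n+s) - (\<Sum>a<K. softmax K Z a (c*n+s) * w a (c*n+s)))) (at 0)"
    unfolding ufm_loss_def Zh softmax_eq
    by (intro DERIV_minus DERIV_sum cross_entropy_has_derivative) auto
  also have "(\<Sum>c<K. \<Sum>s<n. w c (c*n+s) - (\<Sum>a<K. softmax K Z a (c*n+s) * w a (c*n+s))) =
     (\<Sum>c<K. \<Sum>s<n. - (\<Sum>a<K. residual K n Z a (c*n+s) * w a (c*n+s)))"
  proof (intro sum.cong refl)
    fix c s assume "c \<in> {..<K}" "s \<in> {..<n}"
    then have "(c*n+s) div n = c" "c < K" by auto
    then show "w c (c*n+s) - (\<Sum>a<K. softmax K Z a (c*n+s) * w a (c*n+s)) =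
       - (\<Sum>a<K. residual K n Z a (c*n+s) * w a (c*n+s))"
      by (simp add: residual_def left_diff_distrib sum_subtractf sum.delta
          if_distrib[of "\<lambda>x. x * _"] of_bool_def cong: if_cong)
  qed
  also have "\<dots> = (\<Sum>c<n*K. - (\<Sum>a<K. residual K n Z a c * w a c))"
    by (rule sum_nat_blocks)
  finally have "((\<lambda>h. ufm_loss K n d L (upd_entry \<theta> l i j h)) has_real_derivative
      loss_grad K n d L \<theta> l i j) (at 0)"
    by (simp add: loss_grad_def Z_def w_def sum_negf mult.assoc)
  then show ?thesis
    unfolding partial_at_def by (rule DERIV_imp_deriv)
qed

section \<open>Lipschitz estimates and Gronwall's inequality\<close>

text \<open>A congruence for the operations that make up the gradient: it propagates a bound of the
  distance of two curves of parameters to their gradients without computing a Lipschitz constant.\<close>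
definition lip_close :: "'a set \<Rightarrow> ('a \<Rightarrow> real) \<Rightarrow> ('a \<Rightarrow> real) \<Rightarrow> ('a \<Rightarrow> real) \<Rightarrow> bool" where
  "lip_close S e f g \<longleftrightarrow>
     (\<exists>B. \<forall>t\<in>S. \<bar>f t\<bar> \<le> B \<and> \<bar>g t\<bar> \<le> B \<and> \<bar>f t - g t\<bar> \<le> B * e t)"

text \<open>As \<open>e\<close> is nonnegative, every larger constant works too. The threshold form
  lets two bounds be merged by taking a maximum.\<close>

lemma lip_close_common_bound:
  assumes "lip_close S e f g" "\<And>t. t \<in> S \<Longrightarrow> e t \<ge> 0"
  shows "\<exists>B\<ge>1. \<forall>B'\<ge>B. \<forall>t\<in>S. \<bar>f t\<bar> \<le> B' \<and> \<bar>g t\<bar> \<le> B' \<and> \<bar>f t - g t\<bar> \<le> B' * e t"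
proof -
  obtain B where B: "\<forall>t\<in>S. \<bar>f t\<bar> \<le> B \<and> \<bar>g t\<bar> \<le> B \<and> \<bar>f t - g t\<bar> \<le> B * e t"
    using assms(1) unfolding lip_close_def by blast
  show ?thesis
  proof (intro exI[of _ "max 1 B"] conjI allI impI ballI)
    fix B' t assume "B' \<ge> max 1 B" "t \<in> S"
    then have "B \<le> B'" "B * e t \<le> B' * e t" using assms(2) by (auto intro: mult_right_mono)
    then show "\<bar>f t\<bar> \<le> B'" "\<bar>g t\<bar> \<le> B'" "\<bar>f t - g t\<bar> \<le> B' * e t"
      using B \<open>t \<in> S\<close> by force+
  qed simp
qed

context
  fixes S :: "'a set" and e :: "'a \<Rightarrow> real"
  assumes e_nonneg: "\<And>t. t \<in> S \<Longrightarrow> e t \<ge> 0"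
begin

lemma lip_close_const: "lip_close S e (\<lambda>t. c) (\<lambda>t. c)"
  unfolding lip_close_def using e_nonneg by (intro exI[of _ "\<bar>c\<bar>"]) auto

lemma lip_close_pair_bound:
  assumes "lip_close S e f g" "lip_close S e f' g'"
  shows "\<exists>B\<ge>1. \<forall>t\<in>S. (\<bar>f t\<bar> \<le> B \<and> \<bar>g t\<bar> \<le> B \<and> \<bar>f t - g t\<bar> \<le> B * e t) \<and>
    (\<bar>f' t\<bar> \<le> B \<and> \<bar>g' t\<bar> \<le> B \<and> \<bar>f' t - g' t\<bar> \<le> B * e t)"
proof -
  obtain B1 where 1: "B1 \<ge> 1"
    "\<forall>B\<ge>B1. \<forall>t\<in>S. \<bar>f t\<bar> \<le> B \<and> \<bar>g t\<bar> \<le> B \<and> \<bar>f t - g t\<bar> \<le> B * e t"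
    using lip_close_common_bound[OF assms(1) e_nonneg] by blast
  obtain B2 where 2: "\<forall>B\<ge>B2. \<forall>t\<in>S. \<bar>f' t\<bar> \<le> B \<and> \<bar>g' t\<bar> \<le> B \<and> \<bar>f' t - g' t\<bar> \<le> B * e t"
    using lip_close_common_bound[OF assms(2) e_nonneg] by blast
  show ?thesis
    by (rule exI[of _ "max B1 B2"]) (use 1 2 in simp)
qed

lemma lip_close_add:
  assumes "lip_close S e f g" "lip_close S e f' g'"
  shows "lip_close S e (\<lambda>t. f t + f' t) (\<lambda>t. g t + g' t)"
proof -
  obtain B where B: "B \<ge> 1"
    "\<forall>t\<in>S. (\<bar>f t\<bar> \<le> B \<and> \<bar>g t\<bar> \<le> B \<and> \<bar>f t - g t\<bar> \<le> B * e t) \<and>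
      (\<bar>f' t\<bar> \<le> B \<and> \<bar>g' t\<bar> \<le> B \<and> \<bar>f' t - g' t\<bar> \<le> B * e t)"
    using lip_close_pair_bound[OF assms] by blast
  show ?thesis
    unfolding lip_close_def
  proof (intro exI[of _ "2 * B"] ballI)
    fix t assume t: "t \<in> S"
    then show "\<bar>f t + f' t\<bar> \<le> 2 * B \<and> \<bar>g t + g' t\<bar> \<le> 2 * B \<and> \<bar>f t + f' t - (g t + g' t)\<bar> \<le> 2 * B * e t"
      using bspec[OF B(2) t] abs_triangle_ineq[of "f t" "f' t"] abs_triangle_ineq[of "g t" "g' t"]
        abs_triangle_ineq[of "f t - g t" "f' t - g' t"]
      by (simp add: add_diff_add)
  qed
qed

lemma lip_close_mult:
  assumes "lip_close S e f g" "lip_close S e f' g'"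
  shows "lip_close S e (\<lambda>t. f t * f' t) (\<lambda>t. g t * g' t)"
proof -
  obtain B where B: "B \<ge> 1"
    "\<forall>t\<in>S. (\<bar>f t\<bar> \<le> B \<and> \<bar>g t\<bar> \<le> B \<and> \<bar>f t - g t\<bar> \<le> B * e t) \<and>
      (\<bar>f' t\<bar> \<le> B \<and> \<bar>g' t\<bar> \<le> B \<and> \<bar>f' t - g' t\<bar> \<le> B * e t)"
    using lip_close_pair_bound[OF assms] by blast
  show ?thesis
    unfolding lip_close_def
  proof (intro exI[of _ "2 * (B * B)"] ballI)
    fix t assume t: "t \<in> S"
    have b: "\<bar>f t\<bar> * \<bar>f' t\<bar> \<le> B * B" "\<bar>g t\<bar> * \<bar>g' t\<bar> \<le> B * B"
      "\<bar>f t\<bar> * \<bar>f' t - g' t\<bar> \<le> B * (B * e t)" "\<bar>f t - g t\<bar> * \<bar>g' t\<bar> \<le> (B * e t) * B"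
      by (rule mult_mono; use B(1) bspec[OF B(2) t] e_nonneg[OF t] in simp)+
    have "\<bar>f t * f' t - g t * g' t\<bar> = \<bar>f t * (f' t - g' t) + (f t - g t) * g' t\<bar>"
      by (simp add: algebra_simps)
    also have "\<dots> \<le> \<bar>f t\<bar> * \<bar>f' t - g' t\<bar> + \<bar>f t - g t\<bar> * \<bar>g' t\<bar>"
      by (metis abs_mult abs_triangle_ineq)
    also have "\<dots> \<le> 2 * (B * B) * e t" using b(3,4) by (simp add: algebra_simps)
    finally have d: "\<bar>f t * f' t - g t * g' t\<bar> \<le> 2 * (B * B) * e t" .
    have "B * B \<le> 2 * (B * B)" by simp
    then have "\<bar>f t\<bar> * \<bar>f' t\<bar> \<le> 2 * (B * B)" "\<bar>g t\<bar> * \<bar>g' t\<bar> \<le> 2 * (B * B)"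
      using b(1,2) by linarith+
    then show "\<bar>f t * f' t\<bar> \<le> 2 * (B * B) \<and> \<bar>g t * g' t\<bar> \<le> 2 * (B * B) \<and>
        \<bar>f t * f' t - g t * g' t\<bar> \<le> 2 * (B * B) * e t"
      using d by (simp add: abs_mult)
  qed
qed

lemma lip_close_minus:
  assumes "lip_close S e f g" "lip_close S e f' g'"
  shows "lip_close S e (\<lambda>t. f t - f' t) (\<lambda>t. g t - g' t)"
  using lip_close_add[OF assms(1) lip_close_mult[OF lip_close_const[of "-1"] assms(2)]] by simp

lemma lip_close_sum:
  assumes "\<And>i. i \<in> I \<Longrightarrow> lip_close S e (f i) (g i)"
  shows "lip_close S e (\<lambda>t. \<Sum>i\<in>I. f i t) (\<lambda>t. \<Sum>i\<in>I. g i t)"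
  using assms
  by (induction I rule: infinite_finite_induct) (auto intro: lip_close_const lip_close_add)

lemma lip_close_exp:
  assumes "lip_close S e f g"
  shows "lip_close S e (\<lambda>t. exp (f t)) (\<lambda>t. exp (g t))"
proof -
  obtain B where B: "\<forall>t\<in>S. \<bar>f t\<bar> \<le> B \<and> \<bar>g t\<bar> \<le> B \<and> \<bar>f t - g t\<bar> \<le> B * e t" "B \<ge> 1"
    using lip_close_common_bound[OF assms e_nonneg] by blast
  have lip: "\<bar>exp x - exp y\<bar> \<le> exp B * \<bar>x - y\<bar>" if "\<bar>x\<bar> \<le> B" "\<bar>y\<bar> \<le> B" for x y :: real
  proof -
    have "norm (exp x - exp y) \<le> exp B * norm (x - y)"
      by (rule field_differentiable_bound[of "{-B..B}" exp exp])
        (use that in \<open>auto simp: abs_le_iff intro!: derivative_eq_intros\<close>)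
    then show ?thesis by simp
  qed
  show ?thesis
    unfolding lip_close_def
  proof (intro exI[of _ "exp B * B"] ballI)
    fix t assume "t \<in> S"
    then have t: "\<bar>f t\<bar> \<le> B" "\<bar>g t\<bar> \<le> B" "\<bar>f t - g t\<bar> \<le> B * e t" using B by auto
    have "exp B * \<bar>f t - g t\<bar> \<le> exp B * (B * e t)" using t(3) by simp
    moreover have "exp B \<le> exp B * B" using B(2) by simp
    moreover have "exp (f t) \<le> exp B" "exp (g t) \<le> exp B" using t by (auto simp: abs_le_iff)
    ultimately have "exp (f t) \<le> exp B * B" "exp (g t) \<le> exp B * B"
      "\<bar>exp (f t) - exp (g t)\<bar> \<le> exp B * B * e t"
      using lip[OF t(1,2)] unfolding mult.assoc by linarith+
    then show "\<bar>exp (f t)\<bar> \<le> exp B * B \<and> \<bar>exp (g t)\<bar> \<le> exp B * B \<and>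
        \<bar>exp (f t) - exp (g t)\<bar> \<le> exp B * B * e t"
      by simp
  qed
qed

text \<open>On \<open>[1, \<infinity>)\<close> the inverse is 1-Lipschitz with values at most 1, so
  the constant does not grow.\<close>

lemma lip_close_inverse:
  assumes "lip_close S e f g" and "\<And>t. t \<in> S \<Longrightarrow> f t \<ge> 1 \<and> g t \<ge> 1"
  shows "lip_close S e (\<lambda>t. inverse (f t)) (\<lambda>t. inverse (g t))"
proof -
  obtain B where B: "\<forall>t\<in>S. \<bar>f t\<bar> \<le> B \<and> \<bar>g t\<bar> \<le> B \<and> \<bar>f t - g t\<bar> \<le> B * e t" "B \<ge> 1"
    using lip_close_common_bound[OF assms(1) e_nonneg] by blast
  show ?thesis
    unfolding lip_close_def
  proof (intro exI[of _ B] ballI)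
    fix t assume "t \<in> S"
    then have t: "\<bar>f t - g t\<bar> \<le> B * e t" "f t \<ge> 1" "g t \<ge> 1" using B assms(2) by auto
    have le1: "inverse (f t) \<le> 1" "inverse (g t) \<le> 1" using t by (auto intro: inverse_le_1_iff[THEN iffD2])
    have fg: "f t * g t \<ge> 1" using mult_mono[OF t(2,3)] t by simp
    have "\<bar>inverse (f t) - inverse (g t)\<bar> = \<bar>f t - g t\<bar> / (f t * g t)"
      using t by (simp add: field_simps abs_minus_commute)
    also have "\<dots> \<le> \<bar>f t - g t\<bar>"
      using fg by (simp add: divide_le_eq mult_le_cancel_left1)
    finally show "\<bar>inverse (f t)\<bar> \<le> B \<and> \<bar>inverse (g t)\<bar> \<le> B \<and> \<bar>inverse (f t) - inverse (g t)\<bar> \<le> B * e t"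
      using t le1 B(2) by simp
  qed
qed

text \<open>This is the reason for writing \<open>softmax\<close> as the inverse of a sum of
  exponentials of differences: the summand \<open>b = a\<close> equals 1, which keeps the
  denominator at least 1.\<close>

lemma lip_close_residual:
  assumes "\<And>b. b < K \<Longrightarrow> lip_close S e (\<lambda>t. Y t b c) (\<lambda>t. Z t b c)" and "a < K"
  shows "lip_close S e (\<lambda>t. residual K n (Y t) a c) (\<lambda>t. residual K n (Z t) a c)"
proof -
  have ge1: "(\<Sum>b<K. exp (X b c - X a c)) \<ge> (1::real)" for X :: "nat \<Rightarrow> nat \<Rightarrow> real"
    using member_le_sum[of a "{..<K}" "\<lambda>b. exp (X b c - X a c)"] assms(2) by simp
  show ?thesis
    unfolding residual_def softmax_def
    by (intro lip_close_minus lip_close_inverse lip_close_sum lip_close_exp lip_close_const)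
      (use assms ge1 in auto)
qed

context
  fixes \<theta> \<theta>' :: "'a \<Rightarrow> params" and K n d L :: nat
  assumes params_close: "\<And>l i j. l \<le> L \<Longrightarrow> i < layer_rows K d L l \<Longrightarrow> j < layer_cols n K d l
    \<Longrightarrow> lip_close S e (\<lambda>t. \<theta> t l i j) (\<lambda>t. \<theta>' t l i j)"
begin

lemma lip_close_fwd:
  assumes "r \<le> L" "a < layer_rows K d L r" "c < n * K"
  shows "lip_close S e (\<lambda>t. fwd d (\<theta> t) r a c) (\<lambda>t. fwd d (\<theta>' t) r a c)"
  using assms
proof (induction r arbitrary: a)
  case 0
  then show ?case using params_close[of 0 a c] by (simp add: layer_cols_def)
next
  case (Suc r)
  then show ?case
    by (auto intro!: lip_close_sum lip_close_mult params_close simp: layer_cols_def layer_rows_def)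
qed

lemma lip_close_downstream:
  assumes "r \<le> L" "a < layer_rows K d L r"
  shows "lip_close S e (\<lambda>t. downstream d (\<theta> t) l r a i) (\<lambda>t. downstream d (\<theta>' t) l r a i)"
  using assms
proof (induction r arbitrary: a)
  case 0
  then show ?case by (simp add: lip_close_const)
next
  case (Suc r)
  then show ?case
    by (cases "Suc r \<le> l") (auto intro!: lip_close_const lip_close_sum lip_close_mult params_close
        simp: layer_cols_def layer_rows_def simp del: of_bool_eq_1_iff of_bool_eq_0_iff)
qed

lemma lip_close_loss_grad:
  assumes "l \<le> L" "i < layer_rows K d L l" "j < layer_cols n K d l"
  shows "lip_close S e (\<lambda>t. loss_grad K n d L (\<theta> t) l i j) (\<lambda>t. loss_grad K n d L (\<theta>' t) l i j)"
proof -
  have rowsL: "layer_rows K d L L = K" by (simp add: layer_rows_def)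
  have li: "lip_close S e (\<lambda>t. layer_input d (\<theta> t) l j c) (\<lambda>t. layer_input d (\<theta>' t) l j c)"
    if "c < n * K" for c
    using that assms
    by (cases l) (auto simp: layer_input_def layer_rows_def layer_cols_def
        intro!: lip_close_const lip_close_fwd)
  show ?thesis
    unfolding loss_grad_def
    by (intro lip_close_sum lip_close_mult lip_close_residual li lip_close_downstream)
      (auto simp: logits_def rowsL intro!: lip_close_fwd)
qed

end

end

text \<open>The function \<open>y t * exp (- M * t)\<close> is nonincreasing and starts at 0, so it
  is at most 0 at \<open>T\<close>, while \<open>y\<close> is nonnegative.\<close>

lemma gronwall_zero:
  fixes y y' :: "real \<Rightarrow> real"
  assumes deriv: "\<And>t. 0 \<le> t \<Longrightarrow> t \<le> T \<Longrightarrow> (y has_real_derivative y' t) (at t within {0..})"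
    and le: "\<And>t. 0 \<le> t \<Longrightarrow> t \<le> T \<Longrightarrow> y' t \<le> M * y t"
    and "\<And>t. y t \<ge> 0" and "y 0 = 0" and "0 \<le> T"
  shows "y T = 0"
proof -
  define z where "z t = y t * exp (- M * t)" for t
  have dz: "(z has_real_derivative (y' t - M * y t) * exp (- M * t)) (at t within {0..})"
    if "0 \<le> t" "t \<le> T" for t
    unfolding z_def by (rule derivative_eq_intros deriv that refl | simp add: algebra_simps)+
  have "z T \<le> z 0"
  proof (cases "T = 0")
    case False
    show ?thesis
    proof (rule DERIV_nonpos_imp_decreasing_open[of 0 T])
      fix t assume t: "0 < t" "t < T"
      have "at t within {0..} = at t" using t by (intro at_within_interior) auto
      then show "\<exists>D. (z has_real_derivative D) (at t) \<and> D \<le> 0"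
        using dz[of t] le[of t] t by (auto intro!: exI mult_nonpos_nonneg)
    next
      show "continuous_on {0..T} z"
      proof (rule DERIV_continuous_on)
        fix t assume "t \<in> {0..T}"
        then show "(z has_real_derivative (y' t - M * y t) * exp (- M * t)) (at t within {0..T})"
          using dz[of t] by (auto intro: has_field_derivative_subset)
      qed
    qed (use assms in auto)
  qed auto
  then have "y T * exp (- M * T) \<le> 0" using assms(4) by (simp add: z_def)
  then show ?thesis using assms(3)[of T] by (simp add: mult_le_0_iff)
qed

section \<open>Sylvester Hadamard matrices\<close>

lemma sylvester_Suc_low: "k < 2 ^ m \<Longrightarrow> sylvester (Suc m) i k = sylvester m (i mod 2 ^ m) k"
  by simp

lemma sylvester_Suc_high:
  "k < 2 ^ m \<Longrightarrow> sylvester (Suc m) i (2 ^ m + k) =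
     (if 2 ^ m \<le> i then -1 else 1) * sylvester m (i mod 2 ^ m) k"
  by simp

lemma sylvester_commute: "sylvester m i j = sylvester m j i"
  by (induction m arbitrary: i j) auto

lemma sylvester_0: "sylvester m 0 j = 1"
  by (induction m arbitrary: j) auto

lemma sylvester_square: "sylvester m i j * sylvester m i j = 1"
  by (induction m arbitrary: i j) auto

lemma sum_lessThan_double: "(\<Sum>k<2 ^ Suc m. f k) = (\<Sum>k<2 ^ m. f k + f (2 ^ m + k))"
  for f :: "nat \<Rightarrow> real"
  using sum.atLeastLessThan_concat[of 0 "2 ^ m" "2 ^ Suc m" f]
    sum.shift_bounds_nat_ivl[of f 0 "2 ^ m" "2 ^ m"]
  by (simp add: sum.distrib lessThan_atLeast0 mult_2 add.commute)

lemma mod_power2_eqD: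
  fixes i j :: nat
  assumes "i < 2 ^ Suc m" "j < 2 ^ Suc m" "i mod 2 ^ m = j mod 2 ^ m" "2 ^ m \<le> i \<longleftrightarrow> 2 ^ m \<le> j"
  shows "i = j"
  using assms by (cases "2 ^ m \<le> i") (auto simp: le_mod_geq mod_less)

text \<open>Splitting the column index by its leading bit gives the factor
  \<open>1 + ?sg i * ?sg j\<close>, which is 2 if the leading bits of \<open>i\<close> and
  \<open>j\<close> agree and 0 otherwise; the lower bits are left to the induction
  hypothesis.\<close>

lemma sylvester_orthogonal:
  assumes "i < 2 ^ m" "j < 2 ^ m"
  shows "(\<Sum>k<2 ^ m. sylvester m i k * sylvester m j k) = (if i = j then 2 ^ m else 0)"
  using assms
proof (induction m arbitrary: i j)
  case 0
  then show ?case by simp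
next
  case (Suc m)
  let ?sg = "\<lambda>i. if 2 ^ m \<le> i then -1 else (1::real)"
  have "(\<Sum>k<2 ^ Suc m. sylvester (Suc m) i k * sylvester (Suc m) j k) =
      (\<Sum>k<2 ^ m. (1 + ?sg i * ?sg j) * (sylvester m (i mod 2 ^ m) k * sylvester m (j mod 2 ^ m) k))"
    unfolding sum_lessThan_double
    by (rule sum.cong) (simp_all only: sylvester_Suc_low sylvester_Suc_high lessThan_iff, simp)
  also have "\<dots> = (1 + ?sg i * ?sg j) * (if i mod 2 ^ m = j mod 2 ^ m then 2 ^ m else 0)"
    by (simp only: sum_distrib_left[symmetric] Suc.IH mod_less_divisor zero_less_power zero_less_numeral)
  also have "\<dots> = (if i = j then 2 ^ Suc m else 0)"
    using mod_power2_eqD[OF Suc.prems] by auto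
  finally show ?case .
qed

text \<open>The rows form a group under entrywise multiplication: \<open>z\<close> is the bitwise exclusive or
  of \<open>i\<close> and \<open>c\<close>.\<close>
lemma sylvester_row_product:
  assumes "i < 2 ^ m" "c < 2 ^ m"
  shows "\<exists>z<2 ^ m. \<forall>k<2 ^ m. sylvester m i k * sylvester m c k = sylvester m z k"
  using assms
proof (induction m arbitrary: i c)
  case 0
  then show ?case by auto
next
  case (Suc m)
  obtain z where z: "z < 2 ^ m"
    "\<forall>k<2 ^ m. sylvester m (i mod 2 ^ m) k * sylvester m (c mod 2 ^ m) k = sylvester m z k"
    using Suc.IH[of "i mod 2 ^ m" "c mod 2 ^ m"] by auto
  \<comment> \<open>The lower bits come from the induction hypothesis; the leading bit is set
    exactly when those of \<open>i\<close> and \<open>c\<close> differ.\<close>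
  define z' where "z' = (if 2 ^ m \<le> i \<longleftrightarrow> 2 ^ m \<le> c then z else 2 ^ m + z)"
  have z': "z' mod 2 ^ m = z" "2 ^ m \<le> z' \<longleftrightarrow> \<not> (2 ^ m \<le> i \<longleftrightarrow> 2 ^ m \<le> c)"
    using z(1) by (auto simp: z'_def)
  have "sylvester (Suc m) i k * sylvester (Suc m) c k = sylvester (Suc m) z' k" if "k < 2 ^ Suc m" for k
  proof -
    have "sylvester m (i mod 2 ^ m) (k mod 2 ^ m) * sylvester m (c mod 2 ^ m) (k mod 2 ^ m) =
        sylvester m z (k mod 2 ^ m)"
      using z(2) by simp
    then show ?thesis
      using z' by auto
  qed
  moreover have "z' < 2 ^ Suc m" using z(1) by (auto simp: z'_def)
  ultimately show ?case by blast
qed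

lemma sylvester_row_unique:
  assumes "i < 2 ^ m" "j < 2 ^ m" "\<forall>k<2 ^ m. sylvester m i k = sylvester m j k"
  shows "i = j"
proof (rule ccontr)
  assume "i \<noteq> j"
  then have "(\<Sum>k<2 ^ m. sylvester m j k * sylvester m j k) = 0"
    using sylvester_orthogonal[OF assms(1,2)] assms(3) by simp
  then show False
    using sylvester_orthogonal[OF assms(2,2)] by simp
qed

text \<open>Multiplication by row \<open>c\<close> permutes the rows: it is injective because row
  \<open>c\<close> has no zero entry. It sends row \<open>c\<close> to the all-ones row 0, since the
  entries are signs; this moves the label of class \<open>c\<close> to position 0.\<close>

lemma sylvester_row_translation:
  assumes "c < 2 ^ m"
  obtains \<pi> where "bij_betw \<pi> {..<2 ^ m} {..<2 ^ m}"
    and "\<And>i k. i < 2 ^ m \<Longrightarrow> k < 2 ^ m \<Longrightarrow> sylvester m i k * sylvester m c k = sylvester m (\<pi> i) k"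
    and "\<And>i. i < 2 ^ m \<Longrightarrow> \<pi> i = 0 \<longleftrightarrow> i = c"
proof -
  have "\<forall>i\<in>{..<2 ^ m}. \<exists>z. z \<in> {..<2 ^ m} \<and> (\<forall>k<2 ^ m. sylvester m i k * sylvester m c k = sylvester m z k)"
    using sylvester_row_product[OF _ assms] by auto
  from bchoice[OF this] obtain \<pi> where \<pi>: "\<forall>i\<in>{..<2 ^ m}. \<pi> i \<in> {..<2 ^ m} \<and>
      (\<forall>k<2 ^ m. sylvester m i k * sylvester m c k = sylvester m (\<pi> i) k)"
    by blast
  have nz: "sylvester m c k \<noteq> 0" for k using sylvester_square[of m c k] by auto
  have inj: "inj_on \<pi> {..<2 ^ m}"
  proof (rule inj_onI)
    fix i j assume ij: "i \<in> {..<2 ^ m}" "j \<in> {..<2 ^ m}" "\<pi> i = \<pi> j"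
    then have "sylvester m i k * sylvester m c k = sylvester m j k * sylvester m c k" if "k < 2 ^ m" for k
      using \<pi> that by simp
    then show "i = j" using nz ij by (intro sylvester_row_unique) auto
  qed
  have bij: "bij_betw \<pi> {..<2 ^ m} {..<2 ^ m}"
    using inj \<pi> by (simp add: bij_betw_def endo_inj_surj image_subset_iff)
  have c0: "\<pi> c = 0"
    using \<pi> assms by (intro sylvester_row_unique) (auto simp: sylvester_0 sylvester_square dest: bspec[of _ _ c])
  show ?thesis
    using that[OF bij] \<pi> c0 inj assms by (metis inj_onD lessThan_iff)
qed

section \<open>The Walsh-Hadamard transform and the softmax residual in its coordinates\<close>

definition sylvester_transform :: "nat \<Rightarrow> (nat \<Rightarrow> real) \<Rightarrow> nat \<Rightarrow> real" where
  "sylvester_transform m f x = (\<Sum>k<2 ^ m. sylvester m x k * f k)"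

lemma sylvester_transform_divide:
  "sylvester_transform m (\<lambda>k. f k / c) x = sylvester_transform m f x / c"
  by (simp add: sylvester_transform_def sum_divide_distrib)

text \<open>The Sylvester matrix is symmetric with orthogonal rows, so it is its own inverse up to
  the factor \<open>2 ^ m\<close>.\<close>

lemma sylvester_transform_twice:
  assumes "x < 2 ^ m"
  shows "sylvester_transform m (sylvester_transform m f) x = 2 ^ m * f x"
proof -
  have "sylvester_transform m (sylvester_transform m f) x =
      (\<Sum>y<2 ^ m. (\<Sum>k<2 ^ m. sylvester m x k * sylvester m y k) * f y)"
    unfolding sylvester_transform_def sum_distrib_left sum_distrib_right
    by (subst sum.swap) (simp add: mult.assoc sylvester_commute[of m _ "_ :: nat"])
  also have "\<dots> = (\<Sum>y<2 ^ m. (if x = y then 2 ^ m else 0) * f y)"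
    by (rule sum.cong) (use assms in \<open>auto simp: sylvester_orthogonal\<close>)
  also have "\<dots> = (\<Sum>y<2 ^ m. if y = x then 2 ^ m * f x else 0)"
    by (rule sum.cong) auto
  finally show ?thesis using assms by simp
qed

definition class_prob :: "nat \<Rightarrow> (nat \<Rightarrow> real) \<Rightarrow> nat \<Rightarrow> real" where
  "class_prob m g x = exp (g x) / (\<Sum>y<2 ^ m. exp (g y))"

text \<open>For logits with singular values \<open>A\<close>, a column of class 0 is the inner
  transform. Its residual is softmax minus the first unit vector, and transforming back gives the
  coefficients: the factor \<open>2 ^ m\<close> of the double transform cancels against the scale
  \<open>2 ^ m * sqrt n\<close> and leaves \<open>sqrt n\<close>.\<close>

definition residual_coeff :: "nat \<Rightarrow> nat \<Rightarrow> (nat \<Rightarrow> real) \<Rightarrow> nat \<Rightarrow> real" where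
  "residual_coeff m n A k = sqrt n * sylvester_transform m (\<lambda>x.
     class_prob m (sylvester_transform m (\<lambda>k. A k / (2 ^ m * sqrt n))) x - of_bool (x = 0)) k"

text \<open>Column \<open>k * n\<close> pairs column \<open>k\<close> of \<open>U\<close> with
  column 0 of \<open>Q\<close>, whose entries all equal \<open>1 / sqrt n\<close>. Hence it is
  constant on the samples of a class.\<close>

lemma kron_hadamardU_first:
  assumes "n \<ge> 1" "\<forall>j<n. sqrt (real n) * Q j 0 = 1"
  shows "kron n (hadamardU m) Q c (k * n) = sylvester m (c div n) k / (sqrt (2 ^ m) * sqrt n)"
proof -
  have "c mod n < n" using assms(1) by simp
  then have "Q (c mod n) 0 = 1 / sqrt n" using assms by (auto simp: field_simps)
  then show ?thesis using assms(1) by (simp add: kron_def hadamardU_def)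
qed

text \<open>The residual of logits aligned with the Hadamard bases is again aligned with them, because
  its columns are all translates, by the group structure of the rows, of one and the same vector.\<close>
lemma residual_aligned:
  assumes n: "n \<ge> 1" and Q: "\<forall>j<n. sqrt (real n) * Q j 0 = 1" and c: "c < n * 2 ^ m" and a: "a < 2 ^ m"
    and Z: "\<And>b. Z b c = (\<Sum>k<2 ^ m. hadamardU m b k * A k * kron n (hadamardU m) Q c (k * n))"
  shows "residual (2 ^ m) n Z a c =
    (\<Sum>k<2 ^ m. hadamardU m a k * residual_coeff m n A k * kron n (hadamardU m) Q c (k * n))"
proof -
  have c': "c div n < 2 ^ m" using c by (simp add: less_mult_imp_div_less mult.commute)
  obtain \<pi> where bij: "bij_betw \<pi> {..<2 ^ m} {..<2 ^ m}"
    and \<pi>: "\<And>i k. i < 2 ^ m \<Longrightarrow> k < 2 ^ m \<Longrightarrow> sylvester m i k * sylvester m (c div n) k = sylvester m (\<pi> i) k"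
    and \<pi>0: "\<And>i. i < 2 ^ m \<Longrightarrow> \<pi> i = 0 \<longleftrightarrow> i = c div n"
    using sylvester_row_translation[OF c'] by blast
  \<comment> \<open>All dependence on the column \<open>c\<close> is absorbed into the permutation.
    The identity is used once for the logits and once, in the opposite direction, for the
    coefficients of the residual.\<close>
  have aligned: "(\<Sum>k<2 ^ m. hadamardU m b k * f k * kron n (hadamardU m) Q c (k * n)) =
      sylvester_transform m (\<lambda>k. f k / (2 ^ m * sqrt n)) (\<pi> b)" if "b < 2 ^ m" for b f
    unfolding sylvester_transform_def
  proof (rule sum.cong)
    fix k assume "k \<in> {..<(2::nat) ^ m}"
    then have "sylvester m (\<pi> b) k = sylvester m b k * sylvester m (c div n) k"
      using \<pi>[OF that] by simp
    moreover have "x / s * y * (z / (s * r)) = x * z * (y / (K * r))" if "s * s = K"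
      for x y z s r K :: real
      unfolding that[symmetric] by (simp add: mult_ac)
    ultimately show "hadamardU m b k * f k * kron n (hadamardU m) Q c (k * n) =
        sylvester m (\<pi> b) k * (f k / (2 ^ m * sqrt n))"
      unfolding kron_hadamardU_first[where Q = Q, OF n Q] hadamardU_def
      by simp
  qed simp
  define g where "g = sylvester_transform m (\<lambda>k. A k / (2 ^ m * sqrt n))"
  have Zg: "Z b c = g (\<pi> b)" if "b < 2 ^ m" for b
    unfolding g_def Z using aligned[OF that] .
  have "(\<Sum>b<2 ^ m. exp (Z b c)) = (\<Sum>b<2 ^ m. exp (g (\<pi> b)))"
    by (rule sum.cong) (auto simp: Zg)
  also have "\<dots> = (\<Sum>y<2 ^ m. exp (g y))"
    by (rule sum.reindex_bij_betw[OF bij])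
  finally have "residual (2 ^ m) n Z a c = class_prob m g (\<pi> a) - of_bool (\<pi> a = 0)"
    by (simp add: residual_def softmax_eq class_prob_def Zg a \<pi>0)
  moreover have "(\<Sum>k<2 ^ m. hadamardU m a k * residual_coeff m n A k * kron n (hadamardU m) Q c (k * n)) =
      sylvester_transform m (sylvester_transform m (\<lambda>x. class_prob m g x - of_bool (x = 0))) (\<pi> a) / 2 ^ m"
    unfolding aligned[OF a] residual_coeff_def g_def[symmetric]
    using n by (simp add: sylvester_transform_divide)
  moreover have "\<pi> a < 2 ^ m" using bij a by (auto dest: bij_betwE)
  ultimately show ?thesis by (simp add: sylvester_transform_twice)
qed

text \<open>Softmax is invariant under shifts: subtracting \<open>g 0\<close> turns the exponents
  into \<open>-(Psi a)\<close>. Row and column 0 of \<open>Psi\<close> vanish, so \<open>A 0\<close>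
  drops out and the class 0 contributes the summand 1 of the denominator.\<close>

lemma residual_coeff_eq:
  assumes "i < 2 ^ m"
  shows "residual_coeff m n A i = - sqrt n *
    ((\<Sum>j\<in>{1..<2 ^ m}. Psi m i j * exp (- (\<Sum>k\<in>{1..<2 ^ m}. Psi m j k * (A k / (2 ^ m * sqrt n)))))
     / (1 + (\<Sum>j\<in>{1..<2 ^ m}. exp (- (\<Sum>k\<in>{1..<2 ^ m}. Psi m j k * (A k / (2 ^ m * sqrt n)))))))"
proof -
  define a where "a k = A k / (2 ^ m * sqrt n)" for k
  define g where "g = sylvester_transform m a"
  have split0: "(\<Sum>k<2 ^ m. f k) = f 0 + (\<Sum>k\<in>{1..<2 ^ m}. f k)" for f :: "nat \<Rightarrow> real"
    by (simp add: lessThan_atLeast0 sum.atLeast_Suc_lessThan)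
  have g: "exp (g x) = exp (g 0) * exp (- (\<Sum>k\<in>{1..<2 ^ m}. Psi m x k * a k))" for x
  proof -
    have "g x - g 0 = - (\<Sum>k<2 ^ m. Psi m x k * a k)"
      by (simp add: g_def sylvester_transform_def sylvester_0 Psi_def algebra_simps sum_subtractf)
    also have "\<dots> = - (\<Sum>k\<in>{1..<2 ^ m}. Psi m x k * a k)"
      unfolding split0 by (simp add: Psi_def sylvester_commute[of m x 0] sylvester_0)
    finally show ?thesis by (simp add: exp_add[symmetric])
  qed
  define E where "E x = exp (- (\<Sum>k\<in>{1..<2 ^ m}. Psi m x k * a k))" for x
  have E0: "E 0 = 1" by (simp add: E_def Psi_def sylvester_0)
  define D where "D = (\<Sum>y<2 ^ m. E y)"
  have Dpos: "D > 0" unfolding D_def E_def by (intro sum_pos) (auto simp: lessThan_empty_iff)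
  obtain e where e: "e = exp (g 0)" by simp
  have "e > 0" by (simp add: e)
  moreover have "exp (g x) = e * E x" for x
    unfolding e E_def by (rule g)
  ultimately have p: "class_prob m g x = E x / D" for x
    by (simp add: class_prob_def D_def flip: sum_distrib_left)
  have "residual_coeff m n A i = sqrt n * (\<Sum>x<2 ^ m. sylvester m i x * (E x / D - of_bool (x = 0)))"
    unfolding residual_coeff_def a_def[symmetric] g_def[symmetric] p sylvester_transform_def ..
  also have "(\<Sum>x<2 ^ m. sylvester m i x * (E x / D - of_bool (x = 0))) =
      (\<Sum>x<2 ^ m. sylvester m i x * E x) / D - 1"
    unfolding split0
    by (simp add: right_diff_distrib sylvester_commute[of m i 0] sylvester_0 add_divide_distrib sum_divide_distrib)
  \<comment> \<open>The 1 is written as \<open>D / D\<close> and absorbed into the sum, which turns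
    \<open>sylvester\<close> into \<open>- Psi\<close>.\<close>
  also have "\<dots> = - (\<Sum>x<2 ^ m. Psi m i x * E x) / D"
    using Dpos by (simp add: Psi_def left_diff_distrib sum_subtractf field_simps D_def)
  also have "(\<Sum>x<2 ^ m. Psi m i x * E x) = (\<Sum>x\<in>{1..<2 ^ m}. Psi m i x * E x)"
    unfolding split0 by (simp add: Psi_def sylvester_commute[of m i 0] sylvester_0)
  finally show ?thesis
    unfolding D_def split0 E0 unfolding E_def a_def by simp
qed

section \<open>Orthonormality of the columns of the singular bases\<close>

lemma hadamardU_columns_orthonormal:
  assumes "p < 2 ^ m" "q < 2 ^ m"
  shows "(\<Sum>k<2 ^ m. hadamardU m k p * hadamardU m k q) = of_bool (p = q)"
proof -
  have "(\<Sum>k<2 ^ m. hadamardU m k p * hadamardU m k q) =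
      (\<Sum>k<2 ^ m. sylvester m p k * sylvester m q k) / 2 ^ m"
    by (simp add: hadamardU_def sum_divide_distrib sylvester_commute[of m _ p] sylvester_commute[of m _ q])
  then show ?thesis by (simp add: sylvester_orthogonal assms)
qed

lemma kron_hadamardU_columns_orthonormal:
  assumes n: "n \<ge> 1" and Q: "\<forall>j<n. sqrt (real n) * Q j 0 = 1" and "p < 2 ^ m" "q < 2 ^ m"
  shows "(\<Sum>c<n * 2 ^ m. kron n (hadamardU m) Q c (p * n) * kron n (hadamardU m) Q c (q * n)) =
    of_bool (p = q)"
proof -
  have sq: "sqrt (2 ^ m) * sqrt n * (sqrt (2 ^ m) * sqrt n) = 2 ^ m * real n"
    by (simp flip: real_sqrt_mult)
  have "(\<Sum>c<n * 2 ^ m. kron n (hadamardU m) Q c (p * n) * kron n (hadamardU m) Q c (q * n)) =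
     (\<Sum>c<2 ^ m. \<Sum>s<n. hadamardU m c p * hadamardU m c q / n)"
    unfolding sum_nat_blocks[symmetric] kron_hadamardU_first[where Q = Q, OF n Q]
    by (intro sum.cong refl) (simp add: hadamardU_def sq)
  also have "\<dots> = (\<Sum>c<2 ^ m. hadamardU m c p * hadamardU m c q)"
    using n by simp
  finally show ?thesis using assms by (simp add: hadamardU_columns_orthonormal)
qed

lemma sum_swap_pairs:
  "(\<Sum>p\<in>A. \<Sum>q\<in>B. \<Sum>i\<in>C. \<Sum>j\<in>D. f p q i j) = (\<Sum>i\<in>C. \<Sum>j\<in>D. \<Sum>p\<in>A. \<Sum>q\<in>B. f p q i j)"
proof -
  have "(\<Sum>p\<in>A. \<Sum>q\<in>B. \<Sum>i\<in>C. \<Sum>j\<in>D. f p q i j) = (\<Sum>p\<in>A. \<Sum>i\<in>C. \<Sum>j\<in>D. \<Sum>q\<in>B. f p q i j)"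
    by (intro sum.cong refl) (subst sum.swap, intro sum.cong refl, rule sum.swap)
  also have "\<dots> = (\<Sum>i\<in>C. \<Sum>j\<in>D. \<Sum>p\<in>A. \<Sum>q\<in>B. f p q i j)"
    by (subst sum.swap, intro sum.cong refl, rule sum.swap)
  finally show ?thesis .
qed

text \<open>\<open>A\<^sup>T A = I\<close> because the squared Frobenius norm of \<open>A\<^sup>T A - I\<close> expands to
  \<open>tr (A A\<^sup>T A A\<^sup>T) - 2 tr (A A\<^sup>T) + n = 0\<close>.\<close>
lemma orthogonal_mat_columns:
  assumes A: "orthogonal_mat n A" and "p < n" "q < n"
  shows "(\<Sum>i<n. A i p * A i q) = of_bool (p = q)"
proof -
  define M where "M p q = (\<Sum>i<n. A i p * A i q)" for p q
  have row: "(\<Sum>k<n. A i k * A j k) = of_bool (i = j)" if "i < n" "j < n" for i j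
    using A that by (simp add: orthogonal_mat_def)
  have M2: "(\<Sum>p<n. \<Sum>q<n. M p q * M p q) = n"
  proof -
    have "(\<Sum>p<n. \<Sum>q<n. M p q * M p q) =
       (\<Sum>p<n. \<Sum>q<n. \<Sum>i<n. \<Sum>j<n. (A i p * A j p) * (A i q * A j q))"
      unfolding M_def sum_product by (intro sum.cong refl) (simp add: mult_ac)
    also have "\<dots> = (\<Sum>i<n. \<Sum>j<n. \<Sum>p<n. \<Sum>q<n. (A i p * A j p) * (A i q * A j q))"
      by (rule sum_swap_pairs)
    also have "\<dots> = (\<Sum>i<n. \<Sum>j<n. (\<Sum>p<n. A i p * A j p) * (\<Sum>q<n. A i q * A j q))"
      by (simp add: sum_product)
    also have "\<dots> = (\<Sum>i<n. \<Sum>j<n. if i = j then 1 else 0)"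
      by (intro sum.cong refl) (simp add: row)
    also have "\<dots> = n" by simp
    finally show ?thesis .
  qed
  have M1: "(\<Sum>p<n. M p p) = n"
    unfolding M_def by (subst sum.swap) (simp add: row)
  have "(\<Sum>p<n. \<Sum>q<n. (M p q - of_bool (p = q))\<^sup>2) =
     (\<Sum>p<n. \<Sum>q<n. M p q * M p q - (if p = q then 2 * M p p - 1 else 0))"
    by (intro sum.cong refl) (simp add: power2_eq_square algebra_simps)
  also have "\<dots> = 0"
    using M1 M2 by (simp add: sum_subtractf flip: sum_distrib_left)
  finally have "\<forall>p<n. \<forall>q<n. (M p q - of_bool (p = q))\<^sup>2 = 0"
    by (simp add: sum_nonneg_eq_0_iff sum_nonneg)
  then show ?thesis using assms(2,3) by (simp add: M_def)
qed

section \<open>Aligned parameters\<close>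

text \<open>The matrix identity \<open>X U^T U Y = X Y\<close>: this is how the bases of
  neighbouring factors cancel.\<close>

lemma orthonormal_contract:
  fixes u :: "nat \<Rightarrow> nat \<Rightarrow> real"
  assumes "\<And>p q. p < K \<Longrightarrow> q < K \<Longrightarrow> (\<Sum>i<N. u i p * u i q) = of_bool (p = q)"
  shows "(\<Sum>i<N. (\<Sum>p<K. x p * u i p) * (\<Sum>q<K. u i q * y q)) = (\<Sum>p<K. x p * y p)"
proof -
  have "(\<Sum>i<N. (\<Sum>p<K. x p * u i p) * (\<Sum>q<K. u i q * y q)) =
      (\<Sum>i<N. \<Sum>p<K. \<Sum>q<K. (x p * y q) * (u i p * u i q))"
    unfolding sum_product by (intro sum.cong refl) (simp add: mult_ac)
  also have "\<dots> = (\<Sum>p<K. \<Sum>q<K. \<Sum>i<N. (x p * y q) * (u i p * u i q))"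
    by (subst sum.swap, rule sum.cong[OF refl], rule sum.swap)
  also have "\<dots> = (\<Sum>p<K. \<Sum>q<K. if p = q then x p * y p else 0)"
    by (intro sum.cong refl) (simp add: assms flip: sum_distrib_left)
  also have "\<dots> = (\<Sum>p<K. x p * y p)" by simp
  finally show ?thesis .
qed

text \<open>Layer \<open>l\<close> has left singular vectors \<open>lf l\<close> and right singular vectors \<open>rt l\<close>, given by the
  first \<open>K\<close> columns; \<open>\<gamma>\<close> describes the residual of aligned logits.\<close>
locale aligned_frame =
  fixes K n d L :: nat
    and lf rt :: "nat \<Rightarrow> nat \<Rightarrow> nat \<Rightarrow> real"
    and \<gamma> :: "(nat \<Rightarrow> real) \<Rightarrow> nat \<Rightarrow> real"
  assumes rt_Suc: "l < L \<Longrightarrow> rt (Suc l) = lf l"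
    and lf_orthonormal: "l \<le> L \<Longrightarrow> p < K \<Longrightarrow> q < K \<Longrightarrow>
      (\<Sum>i<layer_rows K d L l. lf l i p * lf l i q) = of_bool (p = q)"
    and rt_orthonormal: "l \<le> L \<Longrightarrow> p < K \<Longrightarrow> q < K \<Longrightarrow>
      (\<Sum>j<layer_cols n K d l. rt l j p * rt l j q) = of_bool (p = q)"
    and residual_frame: "a < K \<Longrightarrow> c < n * K \<Longrightarrow>
      (\<And>b. Z b c = (\<Sum>k<K. lf L b k * A k * rt 0 c k)) \<Longrightarrow>
      residual K n Z a c = (\<Sum>k<K. lf L a k * \<gamma> A k * rt 0 c k)"
begin

definition aligned :: "(nat \<Rightarrow> nat \<Rightarrow> real) \<Rightarrow> params" where
  "aligned \<alpha> l i j = (\<Sum>k<K. lf l i k * \<alpha> l k * rt l j k)"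

text \<open>The Frobenius inner product with the rank-one matrix of the \<open>k\<close>-th singular
  pair. These matrices are orthonormal, so \<open>aligned (coord \<theta>)\<close> is the orthogonal
  projection of arbitrary parameters.\<close>

definition coord :: "params \<Rightarrow> nat \<Rightarrow> nat \<Rightarrow> real" where
  "coord \<theta> l k = (\<Sum>i<layer_rows K d L l. \<Sum>j<layer_cols n K d l. lf l i k * rt l j k * \<theta> l i j)"

lemma coord_cong:
  assumes "\<And>i j. i < layer_rows K d L l \<Longrightarrow> j < layer_cols n K d l \<Longrightarrow> \<theta> l i j = \<theta>' l i j"
  shows "coord \<theta> l k = coord \<theta>' l k"
  unfolding coord_def using assms by (intro sum.cong refl) simp

lemma coord_aligned:
  assumes "l \<le> L" "k < K"
  shows "coord (aligned \<alpha>) l k = \<alpha> l k"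
proof -
  \<comment> \<open>Writing a single basis vector as a sum against an indicator brings it into the
    shape of \<open>orthonormal_contract\<close>.\<close>
  have pick: "(\<Sum>q<K. f q * of_bool (q = k)) = f k" for f :: "nat \<Rightarrow> real"
    using assms by (simp add: of_bool_def if_distrib cong: if_cong)
  have "(\<Sum>j<layer_cols n K d l. (\<Sum>p<K. (lf l i p * \<alpha> l p) * rt l j p) * (\<Sum>q<K. rt l j q * of_bool (q = k))) =
      (\<Sum>p<K. lf l i p * \<alpha> l p * of_bool (p = k))" for i
    by (rule orthonormal_contract[OF rt_orthonormal[OF assms(1)]])
  then have inner: "(\<Sum>j<layer_cols n K d l. aligned \<alpha> l i j * rt l j k) = lf l i k * \<alpha> l k" for i
    unfolding pick aligned_def .
  have "coord (aligned \<alpha>) l k = (\<Sum>i<layer_rows K d L l. lf l i k * (\<Sum>j<layer_cols n K d l. aligned \<alpha> l i j * rt l j k))"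
    unfolding coord_def sum_distrib_left by (intro sum.cong refl) (simp add: mult_ac)
  also have "\<dots> = (\<Sum>i<layer_rows K d L l. lf l i k * lf l i k) * \<alpha> l k"
    unfolding inner sum_distrib_right by (simp add: mult.assoc)
  also have "\<dots> = \<alpha> l k" using lf_orthonormal[OF assms(1,2,2)] by simp
  finally show ?thesis .
qed

lemma hidden_orthonormal:
  "r < L \<Longrightarrow> p < K \<Longrightarrow> q < K \<Longrightarrow> (\<Sum>i<d. lf r i p * lf r i q) = of_bool (p = q)"
  using lf_orthonormal[of r p q] by (simp add: layer_rows_def)

lemma aligned_chain:
  assumes "r < L"
  shows "(\<Sum>i<d. aligned \<alpha> (Suc r) a i * (\<Sum>q<K. lf r i q * P q * v q)) =
    (\<Sum>k<K. lf (Suc r) a k * (\<alpha> (Suc r) k * P k) * v k)"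
  using orthonormal_contract[OF hidden_orthonormal[OF assms],
      where x = "\<lambda>p. lf (Suc r) a p * \<alpha> (Suc r) p" and y = "\<lambda>q. P q * v q"]
  by (simp add: aligned_def rt_Suc[OF assms] mult.assoc)

lemma fwd_aligned:
  assumes "r \<le> L"
  shows "fwd d (aligned \<alpha>) r a c = (\<Sum>k<K. lf r a k * (\<Prod>s\<le>r. \<alpha> s k) * rt 0 c k)"
  using assms
proof (induction r arbitrary: a)
  case 0
  then show ?case by (simp add: aligned_def)
next
  case (Suc r)
  then show ?case by (simp add: aligned_chain mult.commute[of "prod _ _"])
qed

lemma downstream_aligned:
  assumes "l < r" "r \<le> L" "i < d"
  shows "downstream d (aligned \<alpha>) l r a i = (\<Sum>k<K. lf r a k * (\<Prod>s\<in>{l<..r}. \<alpha> s k) * lf l i k)"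
  using assms
proof (induction r arbitrary: a)
  case 0
  then show ?case by simp
next
  case (Suc r)
  show ?case
  proof (cases "r = l")
    case True
    \<comment> \<open>With no layer in between, \<open>downstream\<close> is the full identity and
      not the rank-\<open>K\<close> sum of the claim, so the formula starts at one layer.\<close>
    have "(\<Sum>k<d. aligned \<alpha> (Suc l) a k * of_bool (k = i)) = aligned \<alpha> (Suc l) a i"
      using \<open>i < d\<close> by (simp add: of_bool_def if_distrib cong: if_cong)
    moreover have "{l<..Suc l} = {Suc l}" by auto
    ultimately show ?thesis
      using True Suc.prems by (simp add: downstream_self aligned_def rt_Suc)
  next
    case False
    have "{l<..Suc r} = insert (Suc r) {l<..r}" using False Suc.prems by auto
    then show ?thesis
      using False Suc by (simp add: aligned_chain)
  qed
qed

text \<open>The bases contract on both sides of the residual: \<open>lf L\<close> with the layers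
  above \<open>l\<close>, \<open>rt 0\<close> with the layers below. What survives is the residual
  coefficient times the singular values of all other layers.\<close>

lemma loss_grad_aligned:
  assumes l: "l \<le> L" and i: "i < layer_rows K d L l" and j: "j < layer_cols n K d l"
  shows "loss_grad K n d L (aligned \<alpha>) l i j =
    aligned (\<lambda>l k. \<gamma> (\<lambda>k. \<Prod>s\<le>L. \<alpha> s k) k * (\<Prod>s\<in>{..L} - {l}. \<alpha> s k)) l i j"
proof -
  define g where "g = \<gamma> (\<lambda>k. \<Prod>s\<le>L. \<alpha> s k)"
  define B where "B k = g k * (\<Prod>s\<in>{l<..L}. \<alpha> s k)" for k
  have G: "residual K n (logits d L (aligned \<alpha>)) a c = (\<Sum>k<K. lf L a k * g k * rt 0 c k)"
    if "a < K" "c < n * K" for a c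
    unfolding g_def using that by (intro residual_frame) (simp_all add: logits_def fwd_aligned)
  have backprop: "(\<Sum>a<K. residual K n (logits d L (aligned \<alpha>)) a c * downstream d (aligned \<alpha>) l L a i) =
      (\<Sum>k<K. (lf l i k * B k) * rt 0 c k)" if c: "c < n * K" for c
  proof (cases "l = L")
    case True
    then have "i < K" using i by (simp add: layer_rows_def)
    moreover have "(\<Sum>a<K. f a * of_bool (a = i)) = f i" for f :: "nat \<Rightarrow> real"
      using \<open>i < K\<close> by (simp add: of_bool_def if_distrib cong: if_cong)
    ultimately show ?thesis using True c by (simp add: downstream_self G B_def)
  next
    case False
    then have "i < d" "l < L" using i l by (auto simp: layer_rows_def)
    then have "(\<Sum>a<K. residual K n (logits d L (aligned \<alpha>)) a c * downstream d (aligned \<alpha>) l L a i) =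
        (\<Sum>a<K. (\<Sum>p<K. (g p * rt 0 c p) * lf L a p) * (\<Sum>q<K. lf L a q * ((\<Prod>s\<in>{l<..L}. \<alpha> s q) * lf l i q)))"
      using c by (intro sum.cong refl) (simp add: G downstream_aligned mult_ac)
    also have "\<dots> = (\<Sum>p<K. (g p * rt 0 c p) * ((\<Prod>s\<in>{l<..L}. \<alpha> s p) * lf l i p))"
      using lf_orthonormal[of L] by (intro orthonormal_contract) (simp add: layer_rows_def)
    also have "\<dots> = (\<Sum>k<K. (lf l i k * B k) * rt 0 c k)"
      by (simp add: B_def mult_ac)
    finally show ?thesis .
  qed
  have "loss_grad K n d L (aligned \<alpha>) l i j =
      (\<Sum>c<n * K. (\<Sum>k<K. (lf l i k * B k) * rt 0 c k) * layer_input d (aligned \<alpha>) l j c)"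
    unfolding loss_grad_def sum_distrib_right[symmetric]
    by (intro sum.cong refl) (simp add: backprop)
  also have "\<dots> = (\<Sum>k<K. lf l i k * (g k * (\<Prod>s\<in>{..L} - {l}. \<alpha> s k)) * rt l j k)"
  proof (cases l)
    case 0
    have "j < n * K" using j 0 by (simp add: layer_cols_def)
    then have "(\<Sum>c<n * K. f c * of_bool (j = c)) = f j" for f :: "nat \<Rightarrow> real"
      by (simp add: of_bool_def if_distrib cong: if_cong)
    moreover have "{0<..L} = {..L} - {0}" by auto
    ultimately show ?thesis using 0 by (simp add: layer_input_def B_def)
  next
    case (Suc r)
    have "(\<Sum>c<n * K. (\<Sum>k<K. (lf l i k * B k) * rt 0 c k) * layer_input d (aligned \<alpha>) l j c) =
       (\<Sum>c<n * K. (\<Sum>k<K. (lf l i k * B k) * rt 0 c k) *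
          (\<Sum>k<K. rt 0 c k * (lf r j k * (\<Prod>s\<le>r. \<alpha> s k))))"
      using Suc l by (simp add: layer_input_def fwd_aligned mult_ac)
    also have "\<dots> = (\<Sum>k<K. (lf l i k * B k) * (lf r j k * (\<Prod>s\<le>r. \<alpha> s k)))"
      using rt_orthonormal[of 0] by (intro orthonormal_contract) (simp add: layer_cols_def)
    also have "\<dots> = (\<Sum>k<K. lf l i k * (g k * (\<Prod>s\<in>{..L} - {l}. \<alpha> s k)) * rt l j k)"
    proof (intro sum.cong refl)
      fix k
      have "{..L} - {l} = {l<..L} \<union> {..r}" using Suc l by auto
      then have "(\<Prod>s\<in>{..L} - {l}. \<alpha> s k) = (\<Prod>s\<in>{l<..L}. \<alpha> s k) * (\<Prod>s\<le>r. \<alpha> s k)"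
        using Suc by (simp add: prod.union_disjoint disjoint_iff)
      moreover have "rt l = lf r" using Suc l rt_Suc by simp
      ultimately show "(lf l i k * B k) * (lf r j k * (\<Prod>s\<le>r. \<alpha> s k)) =
          lf l i k * (g k * (\<Prod>s\<in>{..L} - {l}. \<alpha> s k)) * rt l j k"
        by (simp add: B_def)
    qed
    finally show ?thesis .
  qed
  finally show ?thesis by (simp add: aligned_def g_def)
qed

end

section \<open>Gradient flow from aligned parameters\<close>

lemma lip_close_continuous:
  fixes f g :: "real \<Rightarrow> real"
  assumes "continuous_on {a..b} f" "continuous_on {a..b} g"
    and "\<And>t. t \<in> {a..b} \<Longrightarrow> \<bar>f t - g t\<bar> \<le> e t"
  shows "lip_close {a..b} e f g"
proof -
  have "\<exists>B. \<forall>t\<in>{a..b}. \<bar>h t\<bar> \<le> B" if "continuous_on {a..b} h" for h :: "real \<Rightarrow> real"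
    using compact_imp_bounded[OF compact_continuous_image[OF that compact_Icc]]
    by (auto simp: bounded_iff)
  from this[OF assms(1)] this[OF assms(2)] obtain B C
    where B: "\<forall>t\<in>{a..b}. \<bar>f t\<bar> \<le> B" and C: "\<forall>t\<in>{a..b}. \<bar>g t\<bar> \<le> C" by blast
  show ?thesis
    unfolding lip_close_def
  \<comment> \<open>The 1 in the maximum is for the distance, which is bounded by \<open>e t\<close>
    itself.\<close>
  proof (intro exI[of _ "max 1 (max B C)"] ballI conjI)
    fix t assume t: "t \<in> {a..b}"
    then have "0 \<le> e t" using assms(3)[OF t] by simp
    then have "1 * e t \<le> max 1 (max B C) * e t" by (intro mult_right_mono) auto
    then show "\<bar>f t - g t\<bar> \<le> max 1 (max B C) * e t" using assms(3)[OF t] by simp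
    show "\<bar>f t\<bar> \<le> max 1 (max B C)" "\<bar>g t\<bar> \<le> max 1 (max B C)"
      using B C t by (auto simp: le_max_iff_disj)
  qed
qed

text \<open>The Lipschitz congruence on a one-point set with distance 0 is an equality, so no second
  induction over the network is needed.\<close>

lemma loss_grad_cong:
  assumes "\<And>l i j. l \<le> L \<Longrightarrow> i < layer_rows K d L l \<Longrightarrow> j < layer_cols n K d l \<Longrightarrow> \<theta> l i j = \<theta>' l i j"
    and "l \<le> L" "i < layer_rows K d L l" "j < layer_cols n K d l"
  shows "loss_grad K n d L \<theta> l i j = loss_grad K n d L \<theta>' l i j"
proof -
  have "lip_close {0::nat} (\<lambda>t. 0) (\<lambda>t. loss_grad K n d L \<theta> l i j) (\<lambda>t. loss_grad K n d L \<theta>' l i j)"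
    using assms by (intro lip_close_loss_grad) (auto simp: lip_close_def)
  then show ?thesis by (auto simp: lip_close_def)
qed

context aligned_frame
begin

lemma flow_aligned:
  assumes flow: "is_grad_flow K n d L \<theta>"
    and init: "\<And>l i j. l \<le> L \<Longrightarrow> i < layer_rows K d L l \<Longrightarrow> j < layer_cols n K d l \<Longrightarrow>
      \<theta> 0 l i j = aligned \<alpha>0 l i j"
    and T: "0 \<le> T" and lij: "l \<le> L" "i < layer_rows K d L l" "j < layer_cols n K d l"
  shows "\<theta> T l i j = aligned (coord (\<theta> T)) l i j"
proof -
  define I where "I = (SIGMA l:{..L}. {..<layer_rows K d L l} \<times> {..<layer_cols n K d l})"
  have finI: "finite I" unfolding I_def by simp
  define F where "F s = loss_grad K n d L (\<theta> s)" for s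
  define dev where "dev \<theta> = (\<lambda>(l, i, j). \<theta> l i j - aligned (coord \<theta>) l i j)" for \<theta>
  have d\<theta>: "((\<lambda>s. \<theta> s l i j) has_real_derivative - F t l i j) (at t within {0..})"
    if "0 \<le> t" "l \<le> L" "i < layer_rows K d L l" "j < layer_cols n K d l" for t l i j
    using flow that partial_at_ufm_loss[OF that(2-4)] unfolding is_grad_flow_def F_def by metis
  have dcoord: "((\<lambda>s. coord (\<theta> s) l k) has_real_derivative - coord (F t) l k) (at t within {0..})"
    if "0 \<le> t" "l \<le> L" for t l k
  proof -
    have "((\<lambda>s. coord (\<theta> s) l k) has_real_derivative
       (\<Sum>i<layer_rows K d L l. \<Sum>j<layer_cols n K d l. lf l i k * rt l j k * - F t l i j)) (at t within {0..})"
      unfolding coord_def using that by (intro DERIV_sum DERIV_cmult d\<theta>) auto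
    then show ?thesis by (simp add: coord_def sum_negf)
  qed
  have daligned: "((\<lambda>s. aligned (coord (\<theta> s)) l i j) has_real_derivative - aligned (coord (F t)) l i j) (at t within {0..})"
    if "0 \<le> t" "l \<le> L" for t l i j
  proof -
    have "((\<lambda>s. aligned (coord (\<theta> s)) l i j) has_real_derivative
       (\<Sum>k<K. lf l i k * - coord (F t) l k * rt l j k)) (at t within {0..})"
      unfolding aligned_def using that by (intro DERIV_sum DERIV_cmult DERIV_cmult_right dcoord) auto
    then show ?thesis by (simp add: aligned_def sum_negf)
  qed
  have ddev: "((\<lambda>s. dev (\<theta> s) x) has_real_derivative - dev (F t) x) (at t within {0..})"
    if t: "0 \<le> t" and xI: "x \<in> I" for t x
  proof -
    obtain l i j where x: "x = (l, i, j)" "l \<le> L" "i < layer_rows K d L l" "j < layer_cols n K d l"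
      using xI unfolding I_def by auto
    show ?thesis
      using DERIV_diff[OF d\<theta>[OF t x(2-4)] daligned[OF t x(2), of i j]]
      by (simp add: dev_def x(1))
  qed
  \<comment> \<open>Gronwall is applied to the squared norm, because \<open>e\<close> need not be
    differentiable where it vanishes.\<close>
  define y where "y s = (\<Sum>x\<in>I. (dev (\<theta> s) x)\<^sup>2)" for s
  define e where "e s = sqrt (y s)" for s
  have y0: "y s \<ge> 0" for s unfolding y_def by (simp add: sum_nonneg)
  have e0: "e s \<ge> 0" "e s * e s = y s" for s using y0 by (auto simp: e_def)
  have en: "0 \<le> e s" if "s \<in> {0..T}" for s by (rule e0(1))
  have dev_le: "\<bar>dev (\<theta> s) x\<bar> \<le> e s" if "x \<in> I" for s x
  proof -
    have "(dev (\<theta> s) x)\<^sup>2 \<le> y s"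
      unfolding y_def by (rule member_le_sum[OF that]) (simp_all add: finI)
    then show ?thesis unfolding e_def using real_le_rsqrt by (metis power2_abs)
  qed
  have cont: "continuous_on {0..T} f" if "\<And>t. 0 \<le> t \<Longrightarrow> (f has_real_derivative f' t) (at t within {0..})" for f f'
  proof (rule DERIV_continuous_on)
    fix t assume "t \<in> {0..T}"
    then show "(f has_real_derivative f' t) (at t within {0..T})"
      using that[of t] by (auto intro: has_field_derivative_subset)
  qed
  have close: "lip_close {0..T} e (\<lambda>s. \<theta> s l i j) (\<lambda>s. aligned (coord (\<theta> s)) l i j)"
    if "l \<le> L" "i < layer_rows K d L l" "j < layer_cols n K d l" for l i j
  proof (rule lip_close_continuous)
    show "\<bar>\<theta> t l i j - aligned (coord (\<theta> t)) l i j\<bar> \<le> e t" for t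
      using dev_le[of "(l, i, j)" t] that by (simp add: dev_def I_def)
  qed (rule cont, rule d\<theta> daligned, use that in auto)+
  define G where "G s = loss_grad K n d L (aligned (coord (\<theta> s)))" for s
  have FG: "lip_close {0..T} e (\<lambda>s. F s l i j) (\<lambda>s. G s l i j)"
    if "l \<le> L" "i < layer_rows K d L l" "j < layer_cols n K d l" for l i j
    unfolding F_def G_def
  proof (rule lip_close_loss_grad)
    show "lip_close {0..T} e (\<lambda>s. \<theta> s l i j) (\<lambda>s. aligned (coord (\<theta> s)) l i j)"
      if "l \<le> L" "i < layer_rows K d L l" "j < layer_cols n K d l" for l i j
      using that by (rule close)
  qed (fact that | rule e0(1))+
  have devFG: "lip_close {0..T} e (\<lambda>s. dev (F s) x) (\<lambda>s. dev (G s) x)" if xI: "x \<in> I" for x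
  proof -
    obtain l i j where x: "x = (l, i, j)" "l \<le> L" "i < layer_rows K d L l" "j < layer_cols n K d l"
      using xI unfolding I_def by auto
    have coord_close: "lip_close {0..T} e (\<lambda>s. coord (F s) l k) (\<lambda>s. coord (G s) l k)" for k
      unfolding coord_def
      by (intro lip_close_sum[OF en] lip_close_mult[OF en lip_close_const[OF en] FG]) (use x in auto)
    have aligned_close: "lip_close {0..T} e (\<lambda>s. aligned (coord (F s)) l i j) (\<lambda>s. aligned (coord (G s)) l i j)"
      unfolding aligned_def
      by (intro lip_close_sum[OF en]
          lip_close_mult[OF en lip_close_mult[OF en lip_close_const[OF en] coord_close] lip_close_const[OF en]])
    show ?thesis
      unfolding dev_def x(1) prod.case
      by (rule lip_close_minus[OF en FG[OF x(2-4)] aligned_close])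
  qed
  have devG: "dev (G s) x = 0" if xI: "x \<in> I" for s x
  proof -
    obtain l i j where x: "x = (l, i, j)" "l \<le> L" "i < layer_rows K d L l" "j < layer_cols n K d l"
      using xI unfolding I_def by auto
    obtain \<beta> where \<beta>: "\<And>l i j. l \<le> L \<Longrightarrow> i < layer_rows K d L l \<Longrightarrow> j < layer_cols n K d l \<Longrightarrow>
        G s l i j = aligned \<beta> l i j"
      unfolding G_def using loss_grad_aligned by blast
    have "coord (G s) l k = \<beta> l k" if "k < K" for k
      using coord_cong[of l "G s" "aligned \<beta>" k] \<beta> x(2) coord_aligned[OF x(2) that] by simp
    then have "aligned (coord (G s)) l i j = aligned \<beta> l i j"
      by (simp add: aligned_def)
    then show ?thesis using \<beta>[OF x(2-4)] by (simp add: dev_def x(1))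
  qed
  \<comment> \<open>As \<open>dev (G t) x\<close> is 0, the bound on the difference is a bound on
    \<open>dev (F t) x\<close> alone.\<close>
  have "\<exists>B. \<forall>t\<in>{0..T}. \<bar>dev (F t) x\<bar> \<le> B * e t" if "x \<in> I" for x
    using devFG[OF that] unfolding lip_close_def devG[OF that] by auto
  then obtain B where B: "\<And>x t. x \<in> I \<Longrightarrow> t \<in> {0..T} \<Longrightarrow> \<bar>dev (F t) x\<bar> \<le> B x * e t"
    by metis
  have "y T = 0"
  proof (rule gronwall_zero[where y = y and T = T and M = "\<Sum>x\<in>I. 2 * B x" and
        y' = "\<lambda>t. \<Sum>x\<in>I. 2 * dev (\<theta> t) x * - dev (F t) x"])
    fix t assume t: "0 \<le> t" "t \<le> T"
    show "(y has_real_derivative (\<Sum>x\<in>I. 2 * dev (\<theta> t) x * - dev (F t) x)) (at t within {0..})"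
      unfolding y_def
    proof (rule DERIV_sum)
      fix x assume "x \<in> I"
      then show "((\<lambda>s. (dev (\<theta> s) x)\<^sup>2) has_real_derivative 2 * dev (\<theta> t) x * - dev (F t) x) (at t within {0..})"
        using DERIV_power[OF ddev[OF t(1)], of x 2] by (simp add: mult_ac)
    qed
    show "(\<Sum>x\<in>I. 2 * dev (\<theta> t) x * - dev (F t) x) \<le> (\<Sum>x\<in>I. 2 * B x) * y t"
      unfolding sum_distrib_right
    proof (rule sum_mono)
      fix x assume x: "x \<in> I"
      have "dev (\<theta> t) x * - dev (F t) x \<le> \<bar>dev (\<theta> t) x\<bar> * \<bar>dev (F t) x\<bar>"
        by (metis abs_ge_self abs_minus_cancel abs_mult)
      also have "\<dots> \<le> e t * (B x * e t)"
        using dev_le[OF x, of t] B[OF x, of t] t e0(1)[of t] by (intro mult_mono) auto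
      also have "\<dots> = B x * y t" using e0(2)[of t] by (simp add: mult_ac)
      finally show "2 * dev (\<theta> t) x * - dev (F t) x \<le> 2 * B x * y t"
        unfolding mult.assoc by (rule mult_left_mono) simp
    qed
  next
    have "coord (\<theta> 0) l k = \<alpha>0 l k" if "l \<le> L" "k < K" for l k
      using coord_cong[of l "\<theta> 0" "aligned \<alpha>0" k] init that(1) coord_aligned[OF that] by simp
    then have "dev (\<theta> 0) x = 0" if "x \<in> I" for x
      using that init by (auto simp: dev_def I_def aligned_def)
    then show "y 0 = 0" by (simp add: y_def)
  qed (rule y0 T)+
  then have "e T = 0" by (simp add: e_def)
  then show ?thesis
    using dev_le[of "(l, i, j)" T] lij by (simp add: dev_def I_def)
qed

text \<open>The flow now equals its projection, so its gradient is that of aligned parameters, and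
  the linear map \<open>coord\<close> reads off the coefficients.\<close>

lemma coord_flow:
  assumes flow: "is_grad_flow K n d L \<theta>"
    and init: "\<And>l i j. l \<le> L \<Longrightarrow> i < layer_rows K d L l \<Longrightarrow> j < layer_cols n K d l \<Longrightarrow>
      \<theta> 0 l i j = aligned \<alpha>0 l i j"
    and t: "0 \<le> t" and lk: "l \<le> L" "k < K"
  shows "((\<lambda>s. coord (\<theta> s) l k) has_real_derivative
    - (\<gamma> (\<lambda>k. \<Prod>s\<le>L. coord (\<theta> t) s k) k * (\<Prod>s\<in>{..L} - {l}. coord (\<theta> t) s k))) (at t within {0..})"
proof -
  define \<beta> where "\<beta> = (\<lambda>l k. \<gamma> (\<lambda>k. \<Prod>s\<le>L. coord (\<theta> t) s k) k * (\<Prod>s\<in>{..L} - {l}. coord (\<theta> t) s k))"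
  have d\<theta>: "((\<lambda>s. \<theta> s l i j) has_real_derivative - aligned \<beta> l i j) (at t within {0..})"
    if "i < layer_rows K d L l" "j < layer_cols n K d l" for i j
  proof -
    have "partial_at (ufm_loss K n d L) (\<theta> t) l i j = loss_grad K n d L (aligned (coord (\<theta> t))) l i j"
      unfolding partial_at_ufm_loss[OF lk(1) that]
      using flow_aligned[OF flow init t] lk(1) that by (intro loss_grad_cong)
    moreover have "((\<lambda>s. \<theta> s l i j) has_real_derivative
        - partial_at (ufm_loss K n d L) (\<theta> t) l i j) (at t within {0..})"
      using flow t lk(1) that unfolding is_grad_flow_def by blast
    ultimately show ?thesis
      by (simp only: loss_grad_aligned[OF lk(1) that] \<beta>_def)
  qed
  have "((\<lambda>s. coord (\<theta> s) l k) has_real_derivative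
     (\<Sum>i<layer_rows K d L l. \<Sum>j<layer_cols n K d l. lf l i k * rt l j k * - aligned \<beta> l i j)) (at t within {0..})"
    unfolding coord_def by (intro DERIV_sum DERIV_cmult d\<theta>) auto
  also have "(\<Sum>i<layer_rows K d L l. \<Sum>j<layer_cols n K d l. lf l i k * rt l j k * - aligned \<beta> l i j) =
      - coord (aligned \<beta>) l k"
    by (simp add: coord_def sum_negf)
  finally show ?thesis unfolding coord_aligned[OF lk] \<beta>_def .
qed

end

section \<open>Dynamics of the singular values\<close>

text \<open>By the integrating factor \<open>exp (- H t)\<close>. It serves twice: differences of
  layers that start at 0 stay 0, and a nonnegative start stays nonnegative.\<close>

lemma linear_ode_sign:
  fixes y h :: "real \<Rightarrow> real"
  assumes deriv: "\<And>t. 0 \<le> t \<Longrightarrow> (y has_real_derivative h t * y t) (at t within {0..})"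
    and cont: "continuous_on {0..} h" and T: "0 \<le> T"
  shows "\<exists>E>0. y T = y 0 * E"
proof -
  define H where "H t = integral {0..t} h" for t
  have "\<exists>c. \<forall>t\<in>{0..T}. y t * exp (- H t) = c"
  proof (rule has_field_derivative_zero_constant)
    fix t assume t: "t \<in> {0..T}"
    have dH: "(H has_real_derivative h t) (at t within {0..T})"
      unfolding H_def using t cont by (intro integral_has_real_derivative) (auto intro: continuous_on_subset)
    have dy: "(y has_real_derivative h t * y t) (at t within {0..T})"
      using deriv[of t] t by (auto intro: has_field_derivative_subset)
    show "((\<lambda>t. y t * exp (- H t)) has_real_derivative 0) (at t within {0..T})"
      by (rule derivative_eq_intros dH dy refl | simp add: algebra_simps)+
  qed simp
  then have "y T * exp (- H T) = y 0 * exp (- H 0)" using T by auto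
  then have "y T = y 0 * exp (H T)" by (simp add: H_def exp_minus field_simps)
  then show ?thesis by (intro exI[of _ "exp (H T)"]) simp
qed

context
  fixes L :: nat and \<alpha> :: "real \<Rightarrow> nat \<Rightarrow> real" and g :: "real \<Rightarrow> real"
  assumes deriv: "\<And>t l. 0 \<le> t \<Longrightarrow> l \<le> L \<Longrightarrow>
    ((\<lambda>s. \<alpha> s l) has_real_derivative - (g t * (\<Prod>s\<in>{..L} - {l}. \<alpha> t s))) (at t within {0..})"
begin

text \<open>The derivative of each square is \<open>-2 * g\<close> times the product over all
  layers, which is the same for every layer.\<close>

lemma singular_values_conserved:
  assumes "0 \<le> t" "l \<le> L" "r \<le> L"
  shows "(\<alpha> t l)\<^sup>2 - (\<alpha> t r)\<^sup>2 = (\<alpha> 0 l)\<^sup>2 - (\<alpha> 0 r)\<^sup>2"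
proof -
  have sq: "((\<lambda>s. (\<alpha> s l)\<^sup>2) has_real_derivative - 2 * (g t * (\<Prod>s\<le>L. \<alpha> t s))) (at t within {0..})"
    if "0 \<le> t" "l \<le> L" for t l
    using DERIV_power[OF deriv[OF that], of 2] that(2)
    by (simp add: prod.remove[of "{..L}" l] mult_ac)
  have "\<exists>c. \<forall>t\<in>{0..}. (\<alpha> t l)\<^sup>2 - (\<alpha> t r)\<^sup>2 = c"
  proof (rule has_field_derivative_zero_constant)
    fix t :: real assume "t \<in> {0..}"
    then show "((\<lambda>s. (\<alpha> s l)\<^sup>2 - (\<alpha> s r)\<^sup>2) has_real_derivative 0) (at t within {0..})"
      using DERIV_diff[OF sq[of t l] sq[of t r]] assms by simp
  qed simp
  then show ?thesis using assms(1) by auto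
qed

context
  assumes g_cont: "continuous_on {0..} g" and L_pos: "L \<ge> 1"
    and balanced: "\<And>l. l \<le> L \<Longrightarrow> \<alpha> 0 l = \<alpha> 0 0" and nonneg: "\<alpha> 0 0 \<ge> 0"
begin

lemma singular_value_continuous: "l \<le> L \<Longrightarrow> continuous_on {0..} (\<lambda>t. \<alpha> t l)"
  by (rule DERIV_continuous_on[OF deriv]) auto

text \<open>Conservation yields only equal squares. The difference of two layers solves a linear
  equation whose coefficient is \<open>g\<close> times the product of the remaining layers.\<close>

lemma singular_values_balanced:
  assumes t: "0 \<le> t" and l: "l \<le> L"
  shows "\<alpha> t l = \<alpha> t 0"
proof (cases "l = 0")
  case False
  define P where "P t = (\<Prod>s\<in>{..L} - {l} - {0}. \<alpha> t s)" for t
  have P: "(\<Prod>s\<in>{..L} - {l}. \<alpha> t s) = \<alpha> t 0 * P t" "(\<Prod>s\<in>{..L} - {0}. \<alpha> t s) = \<alpha> t l * P t" for t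
  proof -
    show "(\<Prod>s\<in>{..L} - {l}. \<alpha> t s) = \<alpha> t 0 * P t"
      unfolding P_def using False by (intro prod.remove) auto
    have "{..L} - {l} - {0} = {..L} - {0} - {l}" by auto
    then show "(\<Prod>s\<in>{..L} - {0}. \<alpha> t s) = \<alpha> t l * P t"
      unfolding P_def using False l by (simp only:) (intro prod.remove, auto)
  qed
  have "\<exists>E>0. \<alpha> t l - \<alpha> t 0 = (\<alpha> 0 l - \<alpha> 0 0) * E"
  proof (rule linear_ode_sign[where h = "\<lambda>t. g t * P t"])
    fix t :: real assume "0 \<le> t"
    then show "((\<lambda>t. \<alpha> t l - \<alpha> t 0) has_real_derivative g t * P t * (\<alpha> t l - \<alpha> t 0)) (at t within {0..})"
      using DERIV_diff[OF deriv[of t l] deriv[of t 0]] l by (simp add: P algebra_simps)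
  next
    show "continuous_on {0..} (\<lambda>t. g t * P t)"
      unfolding P_def by (intro continuous_intros g_cont singular_value_continuous) auto
  qed (rule t)
  then show ?thesis using balanced[OF l] by auto
qed simp

lemma prod_others_balanced:
  assumes "0 \<le> t" shows "(\<Prod>s\<in>{..L} - {0}. \<alpha> t s) = \<alpha> t 0 ^ L"
proof -
  have "(\<Prod>s\<in>{..L} - {0}. \<alpha> t s) = (\<Prod>s\<in>{..L} - {0}. \<alpha> t 0)"
    by (intro prod.cong refl singular_values_balanced[OF assms]) auto
  then show ?thesis by simp
qed

lemma singular_value_nonneg:
  assumes t: "0 \<le> t"
  shows "\<alpha> t 0 \<ge> 0"
proof -
  have "\<exists>E>0. \<alpha> t 0 = \<alpha> 0 0 * E"
  proof (rule linear_ode_sign[where h = "\<lambda>t. - g t * \<alpha> t 0 ^ (L - 1)"])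
    fix t :: real assume t: "0 \<le> t"
    have "\<alpha> t 0 ^ L = \<alpha> t 0 ^ (L - 1) * \<alpha> t 0" using L_pos by (cases L) auto
    then show "((\<lambda>t. \<alpha> t 0) has_real_derivative - g t * \<alpha> t 0 ^ (L - 1) * \<alpha> t 0) (at t within {0..})"
      using deriv[OF t, of 0] prod_others_balanced[OF t] by (simp add: mult.assoc)
  next
    show "continuous_on {0..} (\<lambda>t. - g t * \<alpha> t 0 ^ (L - 1))"
      by (intro continuous_intros g_cont singular_value_continuous) auto
  qed (rule t)
  then show ?thesis using nonneg by auto
qed

lemma singular_value_product:
  assumes "0 \<le> t" shows "(\<Prod>l\<le>L. \<alpha> t l) = \<alpha> t 0 ^ (L + 1)"
proof -
  have "(\<Prod>l\<le>L. \<alpha> t l) = (\<Prod>l\<le>L. \<alpha> t 0)"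
    by (intro prod.cong refl singular_values_balanced[OF assms]) auto
  then show ?thesis by simp
qed

lemma singular_value_product_nonneg: "0 \<le> t \<Longrightarrow> (\<Prod>l\<le>L. \<alpha> t l) \<ge> 0"
  by (simp only: singular_value_product singular_value_nonneg zero_le_power)

text \<open>With \<open>b\<close> the common value, the product \<open>b ^ (L + 1)\<close> has
  derivative \<open>-(L + 1) * g * b ^ (2 * L)\<close>, and \<open>b ^ (2 * L)\<close> is the stated
  power of the product; at \<open>b = 0\<close> both sides vanish because \<open>L\<close> is
  positive.\<close>

lemma singular_value_product_deriv:
  assumes t: "0 \<le> t"
  shows "((\<lambda>s. \<Prod>l\<le>L. \<alpha> s l) has_real_derivative
    - (real (L + 1) * g t * (\<Prod>l\<le>L. \<alpha> t l) powr (2 * real L / real (L + 1)))) (at t within {0..})"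
proof -
  define b where "b = \<alpha> t 0"
  have b0: "b \<ge> 0" unfolding b_def by (rule singular_value_nonneg[OF t])
  have pw: "(b ^ (L + 1)) powr (2 * real L / real (L + 1)) = b ^ L * b ^ L"
  proof (cases "b = 0")
    case True
    then show ?thesis using L_pos by simp
  next
    case False
    then have "b > 0" using b0 by simp
    then have "(b ^ (L + 1)) powr (2 * real L / real (L + 1)) = b powr (real (L + 1) * (2 * real L / real (L + 1)))"
      by (simp only: powr_realpow[symmetric] powr_powr)
    also have "real (L + 1) * (2 * real L / real (L + 1)) = real (L + L)" by simp
    also have "b powr real (L + L) = b ^ L * b ^ L"
      using \<open>b > 0\<close> by (simp only: powr_realpow power_add)
    finally show ?thesis .
  qed
  have "((\<lambda>s. \<alpha> s 0 ^ (L + 1)) has_real_derivative real (L + 1) * (b ^ L * - (g t * b ^ L))) (at t within {0..})"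
    using DERIV_power[OF deriv[OF t, of 0], of "L + 1"] prod_others_balanced[OF t]
    by (simp add: b_def mult_ac)
  then have "((\<lambda>s. \<Prod>l\<le>L. \<alpha> s l) has_real_derivative real (L + 1) * (b ^ L * - (g t * b ^ L))) (at t within {0..})"
    by (rule has_field_derivative_transform_within[of _ _ _ _ 1]) (use t in \<open>auto simp: singular_value_product\<close>)
  moreover have "real (L + 1) * (b ^ L * - (g t * b ^ L)) =
      - (real (L + 1) * g t * (\<Prod>l\<le>L. \<alpha> t l) powr (2 * real L / real (L + 1)))"
    unfolding singular_value_product[OF t] b_def[symmetric] pw by simp
  ultimately show ?thesis by (simp only:)
qed

end

end

lemma residual_coeff_continuous:
  assumes "\<And>k. k < 2 ^ m \<Longrightarrow> continuous_on S (\<lambda>t. A t k)"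
  shows "continuous_on S (\<lambda>t. residual_coeff m n (A t) i)"
proof -
  have pos: "(\<Sum>y<2 ^ m. exp (f y)) \<noteq> (0::real)" for f :: "nat \<Rightarrow> real"
  proof -
    have "(\<Sum>y<2 ^ m. exp (f y)) > 0" by (intro sum_pos) (auto simp: lessThan_empty_iff)
    then show ?thesis by linarith
  qed
  have tr: "continuous_on S (\<lambda>t. sylvester_transform m (f t) x)"
    if "\<And>k. k < 2 ^ m \<Longrightarrow> continuous_on S (\<lambda>t. f t k)" for f :: "_ \<Rightarrow> nat \<Rightarrow> real" and x
    unfolding sylvester_transform_def by (intro continuous_intros that) auto
  have "continuous_on S (\<lambda>t. A t k / (2 ^ m * sqrt n))" if "k < 2 ^ m" for k
    unfolding divide_inverse by (intro continuous_intros assms that)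
  then have inner: "continuous_on S (\<lambda>t. sylvester_transform m (\<lambda>k. A t k / (2 ^ m * sqrt n)) x)" for x
    by (rule tr)
  have "continuous_on S (\<lambda>t. class_prob m (sylvester_transform m (\<lambda>k. A t k / (2 ^ m * sqrt n))) x
      - of_bool (x = 0))" for x
    unfolding class_prob_def by (intro continuous_intros inner ballI pos)
  then show ?thesis
    unfolding residual_coeff_def by (intro continuous_on_mult continuous_on_const tr)
qed

theorem theorem4p2:
  fixes m n L d :: nat
    and Q :: "nat \<Rightarrow> nat \<Rightarrow> real"
    and R :: "nat \<Rightarrow> nat \<Rightarrow> nat \<Rightarrow> real"
    and \<alpha>0 :: "nat \<Rightarrow> nat \<Rightarrow> real"
    and \<theta> :: "real \<Rightarrow> params"
  defines "K \<equiv> (2::nat) ^ m"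
  defines "U \<equiv> hadamardU m"
  defines "V \<equiv> kron n (hadamardU m) Q"
  assumes n_pos: "n \<ge> 1" and L_pos: "L \<ge> 1" and dK: "d \<ge> K"
    and Q_orth: "orthogonal_mat n Q"
    and Q_first: "\<forall>j<n. sqrt (real n) * Q j 0 = 1"
    and R_orth: "\<forall>l\<in>{1..L}. orthogonal_mat d (R l)"
    and alpha_nonneg: "\<forall>l\<le>L. \<forall>i<K. \<alpha>0 l i \<ge> 0"
    and flow: "is_grad_flow K n d L \<theta>"
    and init: "\<forall>l\<le>L. \<forall>i<layer_rows K d L l. \<forall>j<layer_cols n K d l.
                 \<theta> 0 l i j = init_form K n L U V R \<alpha>0 l i j"
  shows "\<exists>\<alpha> :: real \<Rightarrow> nat \<Rightarrow> nat \<Rightarrow> real.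
     (\<forall>l\<le>L. \<forall>i<K. \<alpha> 0 l i = \<alpha>0 l i)
   \<and> (\<forall>t\<ge>0. \<forall>l\<le>L. \<forall>i<layer_rows K d L l. \<forall>j<layer_cols n K d l.
         \<theta> t l i j = init_form K n L U V R (\<alpha> t) l i j)
   \<and> (\<forall>t\<ge>0. \<forall>l\<le>L. \<forall>r\<le>L. \<forall>i<K.
         (\<alpha> t l i)\<^sup>2 - (\<alpha> t r i)\<^sup>2 = (\<alpha>0 l i)\<^sup>2 - (\<alpha>0 r i)\<^sup>2)
   \<and> (\<forall>t\<ge>0. \<forall>l\<le>L. \<alpha> t l 0 = \<alpha>0 l 0)
   \<and> ((\<forall>l\<le>L. \<forall>r\<le>L. \<forall>i<K. \<alpha>0 l i = \<alpha>0 r i) \<longrightarrow>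
       (let c = real (L + 1) * (real K * sqrt (real n)) powr (2 * real L / real (L + 1)) / real K;
            a = (\<lambda>i s. (\<Prod>l\<le>L. \<alpha> (s / c) l i) / (real K * sqrt (real n)))
        in \<forall>s\<ge>0. \<forall>i\<in>{1..<K}.
             ((\<lambda>s'. a i s') has_real_derivative
                ((\<Sum>j\<in>{1..<K}. Psi m i j * exp (- (\<Sum>k\<in>{1..<K}. Psi m j k * a k s)))
                 / (1 + (\<Sum>j\<in>{1..<K}. exp (- (\<Sum>k\<in>{1..<K}. Psi m j k * a k s))))
                 * a i s powr (2 * real L / real (L + 1))))
             (at s within {0..})))"
proof -
  have K: "K = 2 ^ m" and K0: "0 < K" by (simp_all add: K_def)
  define lf where "lf l = (if l = L then U else R (Suc l))" for l
  define rt where "rt l = (if l = 0 then (\<lambda>j k. V j (k * n)) else R l)" for l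
  have R_cols: "(\<Sum>i<d. R l i p * R l i q) = of_bool (p = q)" if "1 \<le> l" "l \<le> L" "p < K" "q < K" for l p q
    using R_orth that dK by (intro orthogonal_mat_columns) auto
  interpret aligned_frame K n d L lf rt "residual_coeff m n"
  proof
    fix l p q assume l: "l \<le> L" and pq: "p < K" "q < K"
    show "(\<Sum>i<layer_rows K d L l. lf l i p * lf l i q) = of_bool (p = q)"
      using l pq R_cols[of "Suc l" p q] hadamardU_columns_orthonormal[of p m q]
      by (auto simp: lf_def layer_rows_def U_def K)
    show "(\<Sum>j<layer_cols n K d l. rt l j p * rt l j q) = of_bool (p = q)"
      using l pq R_cols[of l p q] kron_hadamardU_columns_orthonormal[where Q = Q, OF n_pos Q_first, of p m q]
      by (auto simp: rt_def layer_cols_def V_def K)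
  next
    fix a c :: nat and Z A
    assume "a < K" "c < n * K" and Z: "\<And>b. Z b c = (\<Sum>k<K. lf L b k * A k * rt 0 c k)"
    then show "residual K n Z a c = (\<Sum>k<K. lf L a k * residual_coeff m n A k * rt 0 c k)"
      using residual_aligned[where Z = Z and A = A and Q = Q, OF n_pos Q_first, of c m a]
      by (simp add: lf_def rt_def U_def V_def K)
  qed (simp add: lf_def rt_def)
  have init_form: "init_form K n L U V R \<beta> l i j = aligned \<beta> l i j" for \<beta> l i j
    using L_pos by (simp add: init_form_def aligned_def lf_def rt_def)
  define \<alpha> where "\<alpha> t = coord (\<theta> t)" for t
  have start: "\<theta> 0 l i j = aligned \<alpha>0 l i j"
    if "l \<le> L" "i < layer_rows K d L l" "j < layer_cols n K d l" for l i j
    using init that by (simp add: init_form)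
  have \<alpha>_0: "\<alpha> 0 l i = \<alpha>0 l i" if "l \<le> L" "i < K" for l i
    using coord_cong[of l "\<theta> 0" "aligned \<alpha>0" i] start that coord_aligned[OF that] by (simp add: \<alpha>_def)
  define g where "g i t = residual_coeff m n (\<lambda>k. \<Prod>s\<le>L. \<alpha> t s k) i" for i t
  have d\<alpha>: "((\<lambda>s. \<alpha> s l i) has_real_derivative - (g i t * (\<Prod>s\<in>{..L} - {l}. \<alpha> t s i))) (at t within {0..})"
    if "0 \<le> t" "l \<le> L" "i < K" for t l i
    using coord_flow[OF flow start that] by (simp add: \<alpha>_def g_def)
  have stays: "\<theta> t l i j = init_form K n L U V R (\<alpha> t) l i j"
    if "0 \<le> t" "l \<le> L" "i < layer_rows K d L l" "j < layer_cols n K d l" for t l i j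
    unfolding init_form \<alpha>_def using flow_aligned[OF flow start that] .
  have conserved: "(\<alpha> t l i)\<^sup>2 - (\<alpha> t r i)\<^sup>2 = (\<alpha>0 l i)\<^sup>2 - (\<alpha>0 r i)\<^sup>2"
    if "0 \<le> t" "l \<le> L" "r \<le> L" "i < K" for t l r i
    using singular_values_conserved[of L "\<lambda>s l. \<alpha> s l i" "g i", OF d\<alpha> that(1-3)] that(4)
    by (simp add: \<alpha>_0 that)
  \<comment> \<open>Row 0 of \<open>Psi\<close> is zero: softmax and one-hot label have the same
    total mass.\<close>
  have g0: "g 0 t = 0" for t
    unfolding g_def by (subst residual_coeff_eq) (simp_all add: Psi_def sylvester_0)
  have const: "\<alpha> t l 0 = \<alpha>0 l 0" if t: "0 \<le> t" and l: "l \<le> L" for t l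
  proof -
    have "\<exists>c. \<forall>t\<in>{0..}. \<alpha> t l 0 = c"
    proof (rule has_field_derivative_zero_constant)
      fix t :: real assume "t \<in> {0..}"
      then show "((\<lambda>t. \<alpha> t l 0) has_real_derivative 0) (at t within {0..})"
        using d\<alpha>[of t l 0] l K0 by (simp add: g0)
    qed simp
    then show ?thesis using \<alpha>_0[OF l K0] t by (metis atLeast_iff order_refl)
  qed
  define M where "M = real K * sqrt (real n)"
  define p where "p = 2 * real L / real (L + 1)"
  \<comment> \<open>In the original time, \<open>P / M\<close> grows at the rate
    \<open>(L + 1) * sqrt n * ?q * (M * a) powr p / M\<close>. Since
    \<open>sqrt n / M = 1 / K\<close>, this is \<open>c * ?q * a powr p\<close>, so the new time is
    \<open>c\<close> times the old one.\<close>
  define c where "c = real (L + 1) * M powr p / real K"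
  define a where "a i s = (\<Prod>l\<le>L. \<alpha> (s / c) l i) / M" for i s
  have M0: "M > 0" using K0 n_pos by (simp add: M_def)
  then have c0: "c > 0" using K0 by (simp add: c_def)
  have ode: "((\<lambda>s'. a i s') has_real_derivative
      ((\<Sum>j\<in>{1..<K}. Psi m i j * exp (- (\<Sum>k\<in>{1..<K}. Psi m j k * a k s)))
       / (1 + (\<Sum>j\<in>{1..<K}. exp (- (\<Sum>k\<in>{1..<K}. Psi m j k * a k s)))) * a i s powr p)) (at s within {0..})"
    (is "(_ has_real_derivative ?q * _) _")
    if bal: "\<forall>l\<le>L. \<forall>r\<le>L. \<forall>i<K. \<alpha>0 l i = \<alpha>0 r i" and s: "0 \<le> s" and i: "i < K" for s i
  proof -
    have g_cont: "continuous_on {0..} (g i)"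
      unfolding g_def
    proof (rule residual_coeff_continuous)
      fix k :: nat assume "k < 2 ^ m"
      then have "continuous_on {0..} (\<lambda>t. \<alpha> t l k)" if "l \<le> L" for l
        using that by (intro DERIV_continuous_on[OF d\<alpha>]) (auto simp: K)
      then show "continuous_on {0..} (\<lambda>t. \<Prod>s\<le>L. \<alpha> t s k)"
        by (intro continuous_on_prod) auto
    qed
    define P where "P t = (\<Prod>l\<le>L. \<alpha> t l i)" for t
    have sc: "0 \<le> s / c" using s c0 by simp
    have d\<alpha>i: "((\<lambda>s. \<alpha> s l i) has_real_derivative - (g i t * (\<Prod>s\<in>{..L} - {l}. \<alpha> t s i))) (at t within {0..})"
      if "0 \<le> t" "l \<le> L" for t l
      using that i by (rule d\<alpha>)
    have bal_i: "\<alpha> 0 l i = \<alpha> 0 0 i" if "l \<le> L" for l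
    proof -
      have "\<alpha>0 l i = \<alpha>0 0 i" using bal that i by blast
      then show ?thesis using that i by (simp add: \<alpha>_0)
    qed
    have nonneg_i: "\<alpha> 0 0 i \<ge> 0" using alpha_nonneg i by (simp add: \<alpha>_0)
    note prems = d\<alpha>i g_cont L_pos bal_i nonneg_i sc
    have dP: "(P has_real_derivative - (real (L + 1) * g i (s / c) * P (s / c) powr p)) (at (s / c) within {0..})"
      unfolding P_def p_def
      by (rule singular_value_product_deriv[where \<alpha> = "\<lambda>s l. \<alpha> s l i" and g = "g i"]) (rule prems; assumption?)+
    have P0: "P (s / c) \<ge> 0"
      unfolding P_def
      by (rule singular_value_product_nonneg[where \<alpha> = "\<lambda>s l. \<alpha> s l i" and g = "g i"]) (rule prems; assumption?)+
    have gq: "g i (s / c) = - sqrt n * ?q"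
      using residual_coeff_eq[of i m n "\<lambda>k. \<Prod>l\<le>L. \<alpha> (s / c) l k"] i
      by (simp add: g_def a_def M_def K)
    have "((\<lambda>s. P (s / c)) has_real_derivative - (real (L + 1) * g i (s / c) * P (s / c) powr p) * (1 / c)) (at s within {0..})"
    proof (rule DERIV_image_chain[where f = P and g = "\<lambda>s. s / c", unfolded comp_def])
      show "(P has_real_derivative - (real (L + 1) * g i (s / c) * P (s / c) powr p)) (at (s / c) within (\<lambda>s. s / c) ` {0..})"
        using dP by (rule has_field_derivative_subset) (use c0 in auto)
      show "((\<lambda>s. s / c) has_real_derivative 1 / c) (at s within {0..})"
        by (rule DERIV_cdivide DERIV_ident)+
    qed
    then have "((\<lambda>s. P (s / c) / M) has_real_derivative
        - (real (L + 1) * g i (s / c) * P (s / c) powr p) * (1 / c) / M) (at s within {0..})"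
      by (rule DERIV_cdivide)
    moreover have "- (real (L + 1) * g i (s / c) * P (s / c) powr p) * (1 / c) / M = ?q * (P (s / c) / M) powr p"
    proof -
      have "- (real (L + 1) * g i (s / c) * P (s / c) powr p) * (1 / c) / M =
          ?q * P (s / c) powr p * (real (L + 1) * sqrt n / (c * M))"
        unfolding gq by (simp add: mult_ac)
      also have "real (L + 1) * sqrt n / (c * M) = 1 / M powr p"
      proof -
        define W where "W = M powr p"
        have cW: "c = real (L + 1) * W / real K" unfolding c_def W_def ..
        have "c * M = real (L + 1) * sqrt n * W"
          unfolding cW M_def using K0 by simp
        then show ?thesis
          unfolding W_def[symmetric] using n_pos by simp
      qed
      finally show ?thesis
        using P0 M0 by (simp add: powr_divide)
    qed
    ultimately show ?thesis by (simp only: a_def P_def)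
  qed
  show ?thesis
  proof (intro exI[of _ \<alpha>] conjI allI impI)
    assume "\<forall>l\<le>L. \<forall>r\<le>L. \<forall>i<K. \<alpha>0 l i = \<alpha>0 r i"
    note ode[OF this]
    then show "let c = real (L + 1) * (real K * sqrt (real n)) powr (2 * real L / real (L + 1)) / real K;
            a = (\<lambda>i s. (\<Prod>l\<le>L. \<alpha> (s / c) l i) / (real K * sqrt (real n)))
        in \<forall>s\<ge>0. \<forall>i\<in>{1..<K}.
             ((\<lambda>s'. a i s') has_real_derivative
                ((\<Sum>j\<in>{1..<K}. Psi m i j * exp (- (\<Sum>k\<in>{1..<K}. Psi m j k * a k s)))
                 / (1 + (\<Sum>j\<in>{1..<K}. exp (- (\<Sum>k\<in>{1..<K}. Psi m j k * a k s))))
                 * a i s powr (2 * real L / real (L + 1))))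
             (at s within {0..})"
      unfolding Let_def a_def c_def M_def p_def by auto
  qed (simp_all add: \<alpha>_0 stays conserved const)
qed

end
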